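(* Let $r\ge 1$, let $\mathbb{D}\in\mathbb{R}^{M\times M}$ satisfy $\mathbb{D}+\mathbb{D}^T\le 0$, and let $\mathbf{Y}_r\in\mathbf{V}_\tau^r$ be the solution of the continuous time Galerkin method: $\mathbf{Y}_r(0)=\mathbf{Y}_0$ and $\mathbf{Y}_r'=\mathbb{D}\mathcal{P}_{r-1}\mathbf{Y}_r+\mathcal{P}_{r-1}\mathbf{R}$ in $I_n$, $0\le n\le N-1$. Then for $n=1,\ldots,N-1$, $$\mathbf{Y}_r(t_{n+1})=\frac{P_r(\tau_n\mathbb{D})}{P_r(-\tau_n\mathbb{D})}\mathbf{Y}_r(t_n)+\sum_{k=1}^r(-1)^{k+1}\frac{\phi_{k1}(\tau_n\mathbb{D})}{P_r(-\tau_n\mathbb{D})}\,\mathbf{b}_{k-1}+\tau_n\mathbf{R}_0,$$ where $\phi_{k1}(\lambda)=\det[\mathbb{E}_{r+1}(\lambda)_{k,1}]$.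
   Context: $P_r(z)=\sum_{j=0}^r\frac{(2r-j)!\,r!}{(2r)!\,j!\,(r-j)!}z^j$ is the numerator of the $[r/r]$ Padé approximation of $e^z$. For polynomials $p,q$ and a square matrix $\mathbb{X}$ with $q(\mathbb{X})$ invertible, $\frac{p(\mathbb{X})}{q(\mathbb{X})}=p(\mathbb{X})q(\mathbb{X})^{-1}$; the matrix $P_r(-\tau_n\mathbb{D})$ is invertible. The condition $\mathbb{D}+\mathbb{D}^T\le 0$ means that $\mathbb{D}+\mathbb{D}^T$ is negative semi-definite. For $\lambda$ a scalar variable put $a_k=\frac{\lambda}{2}\frac{1}{2k-1}$, $b_k=-\frac{\lambda}{2}\frac{1}{2k+3}$, $c_k=(-1)^{k+1}$. $\mathbb{E}_{r+1}(\lambda)$ is the $(r+1)\times(r+1)$ matrix with entries: $(k,k)$-entry $a_k$ and $(k,k+1)$-entry $-1$ for $1\le k\le r$; $(k,k+2)$-entry $b_k$ for $1\le k\le r-2$; last row $(c_1,\ldots,c_{r+1})$; all other entries $0$. $\mathbb{X}_{i,j}$ denotes $\mathbb{X}$ with row $i$ and column $j$ removed. Setting: $T>0$, $\mathbf{Y}_0\in\mathbb{R}^M$, $\mathbf{R}\in[L^2(0,T)]^M$, $0=t_0<\cdots<t_N=T$ is a partition, $I_n=(t_n,t_{n+1})$, $\tau_n=t_{n+1}-t_n$. $P^m$ is the set of polynomials of degree at most $m$; $\mathbf{V}_\tau^r$ is the space of continuous $\mathbf{v}:[0,T]\to\mathbb{R}^M$ with $\mathbf{v}|_{I_n}\in[P^r]^M$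 for all $n$; $\mathcal{P}_{r-1}$ is, on each $I_n$, the $L^2(I_n)$-orthogonal projection onto $[P^{r-1}]^M$. The discrete problem has a unique solution. On $I_n$ let $\widetilde L_j(t)=L_j\big(\tfrac{2t-t_n-t_{n+1}}{\tau_n}\big)$, with $L_j$ the Legendre polynomial of degree $j$ on $(-1,1)$ normalized by $L_j(1)=1$, and define $\mathbf{R}_0,\ldots,\mathbf{R}_{r-1}\in\mathbb{R}^M$ (depending on $n$) by $\mathcal{P}_{r-1}\mathbf{R}=\sum_{j=0}^{r-1}\mathbf{R}_j\widetilde L_j$ on $I_n$. Finally $\mathbf{b}_{k-1}=-\frac{\tau_n}{2}\left(\frac{\mathbf{R}_{k-1}}{2k-1}-\frac{\mathbf{R}_{k+1}}{2k+3}\right)$ for $1\le k\le r-2$ and $\mathbf{b}_{k-1}=-\frac{\tau_n}{2}\frac{\mathbf{R}_{k-1}}{2k-1}$ for $k=r-1,r$ (with $k\ge 1$).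
   Formalization: The sum over k is multiplied by the matrix τ_n D, a factor missing in the printed formula, which is false without it: for M = 1, r = 1, D = 0, R = 1 it gives Y_r(t_n) + (3/2)τ_n instead of Y_r(t_n) + τ_n. *)

theory Defs
  imports "HOL-Analysis.Analysis" "Jordan_Normal_Form.Determinant"
    "HOL-Computational_Algebra.Polynomial"
begin

section \<open>Polynomials in a square matrix\<close>

text \<open>The type-class power on \<open>real ^ 'm ^ 'm\<close> is entrywise, hence a separate power for the
  matrix product.\<close>

primrec matrix_power :: "real ^ 'm ^ 'm \<Rightarrow> nat \<Rightarrow> real ^ 'm ^ 'm" where
  "matrix_power X 0 = Finite_Cartesian_Product.mat 1"
| "matrix_power X (Suc k) = X ** matrix_power X k"

definition poly_matrix :: "real poly \<Rightarrow> real ^ 'm ^ 'm \<Rightarrow> real ^ 'm ^ 'm" where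
  "poly_matrix p X = (\<Sum>i\<le>degree p. coeff p i *\<^sub>R matrix_power X i)"

text \<open>The fraction of two square matrices, meaningful for invertible \<open>B\<close>.\<close>

definition matrix_quot :: "real ^ 'm ^ 'm \<Rightarrow> real ^ 'm ^ 'm \<Rightarrow> real ^ 'm ^ 'm" where
  "matrix_quot A B = A ** matrix_inv B"

definition negative_semidefinite :: "real ^ 'm ^ 'm \<Rightarrow> bool" where
  "negative_semidefinite A \<longleftrightarrow> transpose A = A \<and> (\<forall>x. x \<bullet> (A *v x) \<le> 0)"


section \<open>The rational function and the determinants\<close>

definition pade :: "nat \<Rightarrow> real poly" where
  "pade r = (\<Sum>j\<le>r. monom (fact (2 * r - j) * fact r / (fact (2 * r) * fact j * fact (r - j))) j)"

text \<open>\<open>E_matrix r\<close> is the matrix of size \<open>r + 1\<close> over the polynomials in the variable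
  \<open>\<lambda> = monom 1 1\<close>. The library indexes rows and columns from \<open>0\<close>; \<open>k\<close> and \<open>l\<close> are the
  row and column numbers counted from \<open>1\<close>.\<close>

definition E_matrix :: "nat \<Rightarrow> real poly mat" where
  "E_matrix r = Matrix.mat (r + 1) (r + 1) (\<lambda>(i, j).
     let k = i + 1; l = j + 1 in
       if k = r + 1 then (- 1) ^ (l + 1)
       else if l = k then monom (1 / 2 * (1 / (2 * real k - 1))) 1
       else if l = k + 1 then - 1
       else if l = k + 2 \<and> k + 2 \<le> r then monom (- (1 / 2) * (1 / (2 * real k + 3))) 1
       else 0)"

text \<open>\<open>phi r k\<close> is \<open>\<phi>\<^bsub>k1\<^esub>\<close>: row \<open>k\<close> and column \<open>1\<close> (counted from \<open>1\<close>) are deleted.\<close>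

definition phi :: "nat \<Rightarrow> nat \<Rightarrow> real poly" where
  "phi r k = Determinant.det (mat_delete (E_matrix r) (k - 1) 0)"


section \<open>Legendre polynomials and projection\<close>

text \<open>Rodrigues' formula; the normalization is such that the value at \<open>1\<close> is \<open>1\<close>.\<close>

definition legendre :: "nat \<Rightarrow> real poly" where
  "legendre j = Polynomial.smult (1 / (2 ^ j * fact j)) ((pderiv ^^ j) ([:- 1, 0, 1:] ^ j))"

definition vec_poly_on :: "nat \<Rightarrow> real set \<Rightarrow> (real \<Rightarrow> real ^ 'm) \<Rightarrow> bool" where
  "vec_poly_on d S v \<longleftrightarrow>
     (\<forall>i. \<exists>p :: real poly. degree p \<le> d \<and> (\<forall>s\<in>S. vec_nth (v s) i = poly p s))"

definition square_integrable_on :: "(real \<Rightarrow> real ^ 'm) \<Rightarrow> real set \<Rightarrow> bool" where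
  "square_integrable_on f S \<longleftrightarrow>
     f \<in> borel_measurable (lebesgue_on S) \<and> integrable (lebesgue_on S) (\<lambda>s. (norm (f s))\<^sup>2)"

text \<open>The orthogonal projection in \<open>L\<^sup>2(a, b)\<close> onto the vector polynomials of degree at most \<open>d\<close>.
  The result is represented by the polynomial function on the whole real line, which makes it
  unique for \<open>a < b\<close>.\<close>

definition L2_proj :: "nat \<Rightarrow> real \<Rightarrow> real \<Rightarrow> (real \<Rightarrow> real ^ 'm) \<Rightarrow> (real \<Rightarrow> real ^ 'm)" where
  "L2_proj d a b f = (THE p. vec_poly_on d UNIV p \<and>
     (\<forall>q. vec_poly_on d UNIV q \<longrightarrow>
        integral\<^sup>L (lebesgue_on {a<..<b}) (\<lambda>s. (f s - p s) \<bullet> q s) = 0))"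


section \<open>The continuous Galerkin method\<close>

definition time_partition :: "(nat \<Rightarrow> real) \<Rightarrow> nat \<Rightarrow> real \<Rightarrow> bool" where
  "time_partition t N T \<longleftrightarrow> t 0 = 0 \<and> t N = T \<and> (\<forall>n<N. t n < t (Suc n))"

definition V_space :: "(nat \<Rightarrow> real) \<Rightarrow> nat \<Rightarrow> nat \<Rightarrow> (real \<Rightarrow> real ^ 'm) set" where
  "V_space t N r =
     {v. continuous_on {t 0..t N} v \<and> (\<forall>n<N. vec_poly_on r {t n<..<t (Suc n)} v)}"

definition galerkin_solution ::
  "(nat \<Rightarrow> real) \<Rightarrow> nat \<Rightarrow> nat \<Rightarrow> real ^ 'm ^ 'm \<Rightarrow> (real \<Rightarrow> real ^ 'm) \<Rightarrow> real ^ 'm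
    \<Rightarrow> (real \<Rightarrow> real ^ 'm) \<Rightarrow> bool" where
  "galerkin_solution t N r D R Y0 Y \<longleftrightarrow>
     Y \<in> V_space t N r \<and> Y 0 = Y0 \<and>
     (\<forall>n<N. \<forall>s\<in>{t n<..<t (Suc n)}.
        (Y has_vector_derivative
          (D *v L2_proj (r - 1) (t n) (t (Suc n)) Y s + L2_proj (r - 1) (t n) (t (Suc n)) R s))
        (at s))"

text \<open>The coefficients of the expansion of the projected right-hand side on the interval \<open>(a, b)\<close>
  in the transformed Legendre polynomials.\<close>

definition legendre_coeffs ::
  "nat \<Rightarrow> real \<Rightarrow> real \<Rightarrow> (real \<Rightarrow> real ^ 'm) \<Rightarrow> (nat \<Rightarrow> real ^ 'm) \<Rightarrow> bool" where
  "legendre_coeffs r a b R c \<longleftrightarrow>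
     (\<forall>s\<in>{a<..<b}. L2_proj (r - 1) a b R s =
        (\<Sum>j<r. poly (legendre j) ((2 * s - a - b) / (b - a)) *\<^sub>R c j))"

text \<open>For \<open>1 \<le> k \<le> r\<close>, \<open>load r \<tau> c k\<close> is the vector \<open>b\<^bsub>k-1\<^esub>\<close>, built from the Legendre
  coefficients \<open>c\<close>.\<close>

definition load :: "nat \<Rightarrow> real \<Rightarrow> (nat \<Rightarrow> real ^ 'm) \<Rightarrow> nat \<Rightarrow> real ^ 'm" where
  "load r \<tau> c k =
     (if k + 2 \<le> r
      then (- (\<tau> / 2)) *\<^sub>R (c (k - 1) /\<^sub>R (2 * real k - 1) - c (k + 1) /\<^sub>R (2 * real k + 3))
      else (- (\<tau> / 2)) *\<^sub>R (c (k - 1) /\<^sub>R (2 * real k - 1)))"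

text \<open>The update formula contains the factor \<open>\<tau>\<^sub>n D\<close> in front of the sum over \<open>k\<close>.
  It comes from \<open>Y(t\<^bsub>n+1\<^esub>) = Y(t\<^sub>n) + \<tau>\<^sub>n (D y\<^sub>0 + R\<^sub>0)\<close>, where Cramer's rule
  gives the leading Legendre coefficient \<open>y\<^sub>0\<close> of \<open>Y\<close> as the quotient by
  \<open>det (E_matrix r) = P\<^sub>r(-\<lambda>)\<close> of
  \<open>(\<Sum>k=1..r. (-1)\<^bsup>k+1\<^esup> \<phi>\<^bsub>k1\<^esub> b\<^bsub>k-1\<^esub>) + (-1)\<^bsup>r\<^esup> \<phi>\<^bsub>r+1,1\<^esub> Y(t\<^sub>n)\<close>
  at \<open>\<lambda> = \<tau>\<^sub>n D\<close>. The formula as printed in the source omits this factor and is then false: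
  for \<open>D = 0\<close>, \<open>r = 1\<close> the method gives \<open>Y(t\<^bsub>n+1\<^esub>) = Y(t\<^sub>n) + \<tau>\<^sub>n R\<^sub>0\<close>, while the formula
  without the factor gives \<open>Y(t\<^sub>n) + 3/2 \<tau>\<^sub>n R\<^sub>0\<close>.\<close>

end

theory Submission
  imports Defs
begin

text \<open>On one interval write \<open>Y = (\<Sum>j\<le>r. y\<^sub>j L\<^sub>j)\<close> in transformed Legendre polynomials. Projection drops
  \<open>y\<^sub>r\<close>, and since \<open>(2j + 1) L\<^sub>j = L\<^bsub>j+1\<^esub>' - L\<^bsub>j-1\<^esub>'\<close>, comparing coefficients in the method gives
  the first \<open>r\<close> rows of a linear system with matrix \<open>E_matrix r\<close> at \<open>\<tau>D\<close>; the last row is the value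
  of \<open>Y\<close> at the left endpoint. Cramer's rule over \<open>\<real>[\<tau>D]\<close> then yields \<open>y\<^sub>0\<close>.

  The cofactors \<open>C\<^sub>j\<close> of the last row span the kernel of the first \<open>r\<close> rows, so
  \<open>W = (\<Sum>j\<le>r. C\<^sub>j L\<^sub>j)\<close> satisfies \<open>W' = (\<lambda>/2) (W - C\<^sub>r L\<^sub>r)\<close> and is a combination of the derivatives of \<open>L\<^sub>r\<close>.
  Evaluating it at the endpoints gives \<open>W(1) = P\<^sub>r(\<lambda>)\<close> and \<open>W(-1) = P\<^sub>r(-\<lambda>)\<close>. The latter is the
  determinant, and \<open>W(1) - W(-1) = \<lambda> C\<^sub>0\<close> produces the numerator of the Pade quotient.

  Invertibility of \<open>P\<^sub>r(-\<tau>D)\<close> comes from the recurrence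
  \<open>P\<^bsub>n+2\<^esub> = P\<^bsub>n+1\<^esub> + c\<^sub>n \<lambda>\<^sup>2 P\<^sub>n\<close> with \<open>c\<^sub>n > 0\<close>.\<close>

section \<open>Legendre polynomials\<close>

lemma higher_pderiv_pcompose_shift:
  "pcompose ((pderiv ^^ n) p) [:c, 1:] = (pderiv ^^ n) (pcompose p [:c, 1:])"
  for p :: "real poly"
proof (induction n)
  case (Suc n)
  then show ?case
    by (simp add: Suc[symmetric] pderiv_pcompose pderiv_pCons)
qed simp

text \<open>Taylor's formula: moving the expansion point to \<open>c\<close> turns values of higher
  derivatives into coefficients.\<close>

lemma poly_higher_pderiv:
  "poly ((pderiv ^^ n) p) c = fact n * coeff (pcompose p [:c, 1:]) n" for p :: "real poly"
proof -
  have "poly ((pderiv ^^ n) p) c = coeff ((pderiv ^^ n) (pcompose p [:c, 1:])) 0"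
    by (simp add: higher_pderiv_pcompose_shift[symmetric] poly_0_coeff_0[symmetric] poly_pcompose)
  then show ?thesis
    by (simp add: coeff_higher_pderiv pochhammer_fact)
qed

lemma higher_pderiv_Suc: "(pderiv ^^ n) (pderiv p) = pderiv ((pderiv ^^ n) p)"
  by (simp add: funpow_swap1)

lemma pcompose_power: "pcompose (p ^ n) q = pcompose p q ^ n" for p q :: "'a::comm_semiring_1 poly"
  by (induction n) (simp_all add: pcompose_1 pcompose_mult)

text \<open>For \<open>e\<close> equal to 1 or -1 the shift turns x^2 - 1 into x (x + 2e), so the
  power has an \<open>n\<close>-fold zero followed by a binomial expansion. This serves both the
  endpoint values of Legendre derivatives and the vanishing boundary terms in the orthogonality
  proof.\<close>

lemma coeff_quadratic_power_shift:
  fixes e :: real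
  assumes "e\<^sup>2 = 1"
  shows "coeff (pcompose ([:-1, 0, 1:] ^ n) [:e, 1:]) k
    = (if k < n then 0 else of_nat (n choose (k - n)) * (2 * e) ^ (2 * n - k))"
proof -
  have "pcompose ([:-1, 0, 1:] :: real poly) [:e, 1:] = monom 1 1 * [:2 * e, 1:]"
    using assms by (simp add: pcompose_pCons monom_altdef power2_eq_square)
  then have "pcompose ([:-1, 0, 1:] ^ n) [:e, 1:] = monom 1 n * [:2 * e, 1:] ^ n"
    by (simp only: pcompose_power power_mult_distrib) (simp add: monom_power)
  moreover have "coeff ([:2 * e, 1:] ^ n) i = of_nat (n choose i) * (2 * e) ^ (n - i)" for i
    by (cases "i \<le> n")
       (simp_all add: coeff_linear_poly_power degree_linear_power coeff_eq_0 binomial_eq_0)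
  moreover have e: "n - (k - n) = 2 * n - k" if "n \<le> k"
    using that by linarith
  ultimately show ?thesis
    by (auto simp: coeff_monom_mult e)
qed

lemma legendre_0 [simp]: "legendre 0 = 1"
  by (simp add: legendre_def)

lemma legendre_1 [simp]: "legendre (Suc 0) = [:0, 1:]"
  by (simp add: legendre_def pderiv_pCons)

lemma degree_legendre [simp]: "degree (legendre n) = n"
proof -
  have "degree ([:-1, 0, 1:] ^ n :: real poly) = 2 * n"
    by (simp add: degree_power_eq)
  then show ?thesis
    by (simp add: legendre_def degree_higher_pderiv)
qed

lemma lead_coeff_legendre: "coeff (legendre n) n \<noteq> 0"
proof (cases n)
  case (Suc m)
  then show ?thesis
    using leading_coeff_0_iff[of "legendre n"] degree_legendre[of n] by force
qed simp

text \<open>By Rodrigues' formula the left side is a multiple of an (n+i)-th derivative of (x^2 -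
  1)^n, hence of one shifted coefficient. These values later become the coefficients of
  \<open>pade\<close>.\<close>

lemma poly_higher_pderiv_legendre:
  fixes e :: real
  assumes "e\<^sup>2 = 1" and "i \<le> n"
  shows "poly ((pderiv ^^ i) (legendre n)) e = e ^ (n - i) * fact (n + i) / (2 ^ i * fact i * fact (n - i))"
proof -
  have k: "2 * n - (n + i) = n - i"
    by linarith
  have c: "coeff (pcompose ([:-1, 0, 1:] ^ n) [:e, 1:]) (n + i) = of_nat (n choose i) * (2 * e) ^ (n - i)"
    using assms(2) by (subst coeff_quadratic_power_shift[OF assms(1)]) (simp add: k)
  have "(pderiv ^^ i) (legendre n) = Polynomial.smult (1 / (2 ^ n * fact n)) ((pderiv ^^ (n + i)) ([:-1, 0, 1:] ^ n))"
    unfolding legendre_def higher_pderiv_smult add.commute[of n] funpow_add by simp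
  then have "poly ((pderiv ^^ i) (legendre n)) e
      = fact (n + i) * (of_nat (n choose i) * (2 * e) ^ (n - i)) / (2 ^ n * fact n)"
    by (simp add: poly_higher_pderiv c)
  also have "\<dots> = e ^ (n - i) * fact (n + i) / (2 ^ i * fact i * fact (n - i))"
    using assms(2) by (simp add: binomial_fact power_mult_distrib power_diff mult_ac)
  finally show ?thesis .
qed

lemma poly_legendre_endpoint:
  fixes e :: real
  assumes "e\<^sup>2 = 1"
  shows "poly (legendre n) e = e ^ n"
  using poly_higher_pderiv_legendre[OF assms, of 0 n] by simp

lemma poly_legendre_one [simp]: "poly (legendre n) 1 = 1"
  by (simp add: poly_legendre_endpoint)

lemma poly_legendre_minus_one [simp]: "poly (legendre n) (- 1) = (- 1) ^ n"
  by (simp add: poly_legendre_endpoint)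

text \<open>Differentiating w^(n+2) twice leaves a term in x^2 w^n, and x^2 = w + 1 eliminates
  x.\<close>

lemma pderiv2_quadratic_power:
  fixes n :: nat
  defines "w \<equiv> [:-1, 0, 1:] :: real poly"
  shows "pderiv (pderiv (w ^ Suc (Suc n))) = Polynomial.smult (2 * (real n + 2) * (2 * real n + 3)) (w ^ Suc n)
    + Polynomial.smult (4 * (real n + 1) * (real n + 2)) (w ^ n)"
proof -
  define x :: "real poly" where "x = [:0, 1:]"
  have x2: "x * x = w + 1"
    by (simp add: x_def w_def one_pCons)
  have dw: "pderiv w = Polynomial.smult 2 x" and dx: "pderiv x = 1"
    by (simp_all add: x_def w_def pderiv_pCons)
  show ?thesis
  proof (rule poly_eq_poly_eq_iff[THEN iffD1], rule ext)
    fix y :: real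
    have "poly (x * x) y = poly (w + 1) y"
      by (simp only: x2)
    then have y: "y * y = poly w y + 1"
      by (simp add: x_def)
    have yy: "y * (c * y) = c * (poly w y + 1)" for c
      by (simp only: y[symmetric] mult_ac)
    have "poly x y = y"
      by (simp add: x_def)
    then show "poly (pderiv (pderiv (w ^ Suc (Suc n)))) y
        = poly (Polynomial.smult (2 * (real n + 2) * (2 * real n + 3)) (w ^ Suc n)
            + Polynomial.smult (4 * (real n + 1) * (real n + 2)) (w ^ n)) y"
      unfolding pderiv_power_Suc pderiv_smult pderiv_mult dw dx
      by (simp add: yy) (simp add: algebra_simps)
  qed
qed

text \<open>Applying n + 1 more derivatives to the identity for w^(n+2) turns its three terms, by
  Rodrigues' formula, into multiples of L_(n+2)', L_(n+1) and L_n'; \<open>f\<close> and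
  \<open>c\<close> match the normalizations.\<close>

lemma pderiv_legendre_recurrence:
  "pderiv (legendre (Suc (Suc n))) - pderiv (legendre n) = Polynomial.smult (2 * real n + 3) (legendre (Suc n))"
proof -
  define w :: "real poly" where "w = [:-1, 0, 1:]"
  have 1: "pderiv ((pderiv ^^ Suc (Suc n)) (w ^ Suc (Suc n))) =
      Polynomial.smult (2 * (real n + 2) * (2 * real n + 3)) ((pderiv ^^ Suc n) (w ^ Suc n))
      + Polynomial.smult (4 * (real n + 1) * (real n + 2)) ((pderiv ^^ Suc n) (w ^ n))"
    using arg_cong[OF pderiv2_quadratic_power[of n], of "pderiv ^^ Suc n"]
    by (simp only: w_def higher_pderiv_add higher_pderiv_smult higher_pderiv_Suc) simp
  have 2: "(pderiv ^^ Suc n) (w ^ n) = pderiv ((pderiv ^^ n) (w ^ n))"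
    by simp
  have f: "fact (Suc (Suc n)) = (real n + 2) * (real n + 1) * fact n" "fact (Suc n) = (real n + 1) * fact n"
    by (simp_all add: algebra_simps)
  have c: "1 / (2 ^ Suc (Suc n) * ((real n + 2) * (real n + 1) * fact n)) * (2 * (real n + 2) * (2 * real n + 3))
      = (2 * real n + 3) * (1 / (2 ^ Suc n * ((real n + 1) * fact n)))"
    "1 / (2 ^ Suc (Suc n) * ((real n + 2) * (real n + 1) * fact n)) * (4 * (real n + 1) * (real n + 2))
      = 1 / (2 ^ n * fact n)"
    by (simp_all add: divide_simps) (simp_all add: algebra_simps)
  show ?thesis
    unfolding legendre_def pderiv_smult w_def[symmetric] 1 2 smult_add_right smult_smult f c
    by simp
qed

section \<open>Legendre expansions of derivatives\<close>

lemma pderiv_sum: "pderiv (sum f A) = (\<Sum>x\<in>A. pderiv (f x))" for f :: "_ \<Rightarrow> real poly"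
  using higher_pderiv_sum[of 1] by simp

lemma smult_sum_right: "Polynomial.smult a (sum f A) = (\<Sum>x\<in>A. Polynomial.smult a (f x))"
  by (induction A rule: infinite_finite_induct) (simp_all add: smult_add_right)

lemma legendre_expansion:
  "degree p \<le> r \<Longrightarrow> \<exists>c. p = (\<Sum>j\<le>r. Polynomial.smult (c j) (legendre j))"
proof (induction r arbitrary: p)
  case 0
  then obtain a where "p = [:a:]"
    using degree_eq_zeroE by auto
  then show ?case
    by (intro exI[of _ "\<lambda>_. a"]) simp
next
  case (Suc r)
  \<comment> \<open>This multiple of the top Legendre polynomial removes the leading coefficient of
    \<open>p\<close>.\<close>
  define a where "a = coeff p (Suc r) / coeff (legendre (Suc r)) (Suc r)"
  define q where "q = p - Polynomial.smult a (legendre (Suc r))"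
  have "coeff q (Suc r) = 0"
    using lead_coeff_legendre[of "Suc r"] by (simp add: q_def a_def)
  moreover have "degree q \<le> Suc r"
    unfolding q_def using Suc.prems by (intro degree_diff_le) (auto intro: order.trans[OF degree_smult_le])
  ultimately have "degree q \<le> r"
    by (metis le_SucE leading_coeff_0_iff degree_0 zero_le)
  then obtain c where c: "q = (\<Sum>j\<le>r. Polynomial.smult (c j) (legendre j))"
    using Suc.IH by blast
  have "p = (\<Sum>j\<le>Suc r. Polynomial.smult ((c(Suc r := a)) j) (legendre j))"
    using c by (simp add: q_def algebra_simps)
  then show ?case
    by blast
qed

text \<open>The derivatives of L_1, ..., L_r have distinct degrees, so the top coefficient vanishes
  first and induction handles the rest. Index 0 is excluded because L_0' = 0.\<close>

lemma pderiv_legendre_independent: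
  assumes "(\<Sum>k\<le>r. Polynomial.smult (e k) (pderiv (legendre k))) = 0" and "1 \<le> k" "k \<le> r"
  shows "e k = 0"
  using assms
proof (induction r)
  case (Suc r)
  have "coeff (pderiv (legendre k)) r = 0" if "k \<le> r" for k
    using that by (simp add: coeff_pderiv coeff_eq_0)
  then have "(\<Sum>k\<le>r. e k * coeff (pderiv (legendre k)) r) = 0"
    by (intro sum.neutral) simp
  then have "coeff (\<Sum>k\<le>Suc r. Polynomial.smult (e k) (pderiv (legendre k))) r
      = e (Suc r) * (of_nat (Suc r) * coeff (legendre (Suc r)) (Suc r))"
    by (simp add: coeff_sum coeff_pderiv)
  then have "e (Suc r) = 0"
    unfolding Suc.prems(1) using lead_coeff_legendre[of "Suc r"] by (auto simp del: of_nat_Suc)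
  with Suc show ?case
    by (cases "k = Suc r") simp_all
qed simp

text \<open>Truncated subtraction makes the case \<open>j = 0\<close> correct, because \<open>legendre 0\<close> is constant.\<close>

lemma legendre_eq_pderiv:
  "legendre j = Polynomial.smult (1 / (2 * real j + 1)) (pderiv (legendre (Suc j)) - pderiv (legendre (j - 1)))"
proof (cases j)
  case 0
  then show ?thesis
    by (simp add: pderiv_pCons)
next
  case (Suc n)
  then show ?thesis
    using pderiv_legendre_recurrence[of n] by (simp add: add.commute)
qed

text \<open>Collecting the terms of \<open>legendre_eq_pderiv\<close> by derivative: L_k' is reached
  from j = k - 1 and, if that index is below \<open>r\<close>, from j = k + 1. The coefficient at
  \<open>k = 0\<close> is arbitrary since L_0' = 0. The others are the pattern of the rows of
  \<open>E_matrix\<close> and of \<open>load\<close>.\<close>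

lemma sum_legendre_eq_pderiv:
  "(\<Sum>j<r. Polynomial.smult (z j) (legendre j)) =
    (\<Sum>k\<le>r. Polynomial.smult (z (k - 1) / (2 * real k - 1) - (if k + 2 \<le> r then z (k + 1) / (2 * real k + 3) else 0))
      (pderiv (legendre k)))"
proof -
  let ?d = "\<lambda>k. pderiv (legendre k)"
  have 1: "(\<Sum>k\<le>r. Polynomial.smult (z (k - 1) / (2 * real k - 1)) (?d k))
      = (\<Sum>j<r. Polynomial.smult (z j / (2 * real j + 1)) (?d (Suc j)))"
    unfolding lessThan_Suc_atMost[symmetric] sum.lessThan_Suc_shift by (simp add: add.commute)
  \<comment> \<open>Here j = k + 1; the additional term j = 0 on the right vanishes because
    \<open>0 - 1 = 0\<close> and L_0' = 0.\<close>
  have 2: "(\<Sum>k\<le>r. Polynomial.smult (if k + 2 \<le> r then z (k + 1) / (2 * real k + 3) else 0) (?d k))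
      = (\<Sum>j<r. Polynomial.smult (z j / (2 * real j + 1)) (?d (j - 1)))"
  proof (cases "r \<ge> 2")
    case True
    then obtain m where m: "r = Suc (Suc m)"
      by (metis add_2_eq_Suc le_Suc_ex)
    have "(\<Sum>k\<le>r. Polynomial.smult (if k + 2 \<le> r then z (k + 1) / (2 * real k + 3) else 0) (?d k))
        = (\<Sum>k<Suc m. Polynomial.smult (z (Suc k) / (2 * real k + 3)) (?d k))"
      unfolding m lessThan_Suc_atMost[symmetric] by simp
    also have "\<dots> = (\<Sum>j<r. Polynomial.smult (z j / (2 * real j + 1)) (?d (j - 1)))"
      unfolding m sum.lessThan_Suc_shift[of _ "Suc m"] by (simp add: add.commute)
    finally show ?thesis .
  next
    case False
    then have "r = 0 \<or> r = 1"
      by linarith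
    then show ?thesis
      by auto
  qed
  have "(\<Sum>j<r. Polynomial.smult (z j) (legendre j)) =
      (\<Sum>j<r. Polynomial.smult (z j / (2 * real j + 1)) (?d (Suc j)))
      - (\<Sum>j<r. Polynomial.smult (z j / (2 * real j + 1)) (?d (j - 1)))"
    by (subst legendre_eq_pderiv) (simp add: sum_subtractf[symmetric] smult_diff_right)
  then show ?thesis
    unfolding 1[symmetric] 2[symmetric] by (simp add: sum_subtractf[symmetric] smult_diff_left)
qed

lemma legendre_derivative_coeffs:
  assumes "(\<Sum>k\<le>r. Polynomial.smult (y k) (pderiv (legendre k)))
      = Polynomial.smult h (\<Sum>j<r. Polynomial.smult (z j) (legendre j))"
    and "1 \<le> k" "k \<le> r"
  shows "y k = h * (z (k - 1) / (2 * real k - 1) - (if k + 2 \<le> r then z (k + 1) / (2 * real k + 3) else 0))"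
proof -
  let ?g = "\<lambda>k. z (k - 1) / (2 * real k - 1) - (if k + 2 \<le> r then z (k + 1) / (2 * real k + 3) else 0)"
  have "(\<Sum>k\<le>r. Polynomial.smult (y k - h * ?g k) (pderiv (legendre k))) = 0"
    using assms(1) unfolding sum_legendre_eq_pderiv
    by (simp add: smult_diff_left[of "y _"] sum_subtractf smult_sum_right)
  then have "y k - h * ?g k = 0"
    using assms(2,3) by (rule pderiv_legendre_independent)
  then show ?thesis
    by simp
qed

text \<open>Converse of \<open>legendre_derivative_coeffs\<close>; it recovers a differential
  equation from the recurrence satisfied by the cofactors.\<close>

lemma legendre_derivative_eqI:
  assumes "\<And>k. 1 \<le> k \<Longrightarrow> k \<le> r \<Longrightarrow>
    y k = h * (z (k - 1) / (2 * real k - 1) - (if k + 2 \<le> r then z (k + 1) / (2 * real k + 3) else 0))"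
  shows "(\<Sum>k\<le>r. Polynomial.smult (y k) (pderiv (legendre k)))
      = Polynomial.smult h (\<Sum>j<r. Polynomial.smult (z j) (legendre j))"
proof -
  have "Polynomial.smult (y k) (pderiv (legendre k)) =
      Polynomial.smult (h * (z (k - 1) / (2 * real k - 1)
      - (if k + 2 \<le> r then z (k + 1) / (2 * real k + 3) else 0))) (pderiv (legendre k))" if "k \<le> r" for k
    using that
    by (cases "k = 0") (simp, rule arg_cong[where f = "\<lambda>c. Polynomial.smult c _", OF assms], auto)
  then show ?thesis
    unfolding sum_legendre_eq_pderiv smult_sum_right by (intro sum.cong) simp_all
qed

text \<open>Integration over [-1, 1]: the two sums are the endpoint values of the expansion with
  coefficients \<open>y\<close>, and among the Legendre polynomials only L_0 has nonzero integral,
  namely 2.\<close>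

lemma legendre_derivative_increment:
  assumes "(\<Sum>k\<le>r. Polynomial.smult (y k) (pderiv (legendre k)))
      = Polynomial.smult h (\<Sum>j<r. Polynomial.smult (z j) (legendre j))"
    and "r \<ge> 1"
  shows "(\<Sum>k\<le>r. y k) - (\<Sum>k\<le>r. (- 1) ^ k * y k) = 2 * h * z 0"
proof -
  \<comment> \<open>Explicit antiderivatives. For j >= 1 the two Legendre polynomials in the
    difference have the same parity and hence equal endpoint values.\<close>
  define I where "I j = (if j = 0 then legendre 1
    else Polynomial.smult (1 / (2 * real j + 1)) (legendre (Suc j) - legendre (j - 1)))" for j
  have dI: "pderiv (I j) = legendre j" for j
    using legendre_eq_pderiv[of j] by (simp add: I_def pderiv_smult pderiv_diff pderiv_pCons)
  have I1: "poly (I j) 1 - poly (I j) (- 1) = (if j = 0 then 2 else 0)" for j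
    by (cases j) (simp_all add: I_def)
  define W where "W = (\<Sum>k\<le>r. Polynomial.smult (y k) (legendre k))"
  define V where "V = Polynomial.smult h (\<Sum>j<r. Polynomial.smult (z j) (I j))"
  have "pderiv (W - V) = 0"
    using assms(1) by (simp add: W_def V_def pderiv_diff pderiv_sum pderiv_smult dI)
  then obtain c where "W - V = [:c:]"
    using pderiv_iszero by blast
  then have "poly (W - V) 1 = poly (W - V) (- 1)"
    by simp
  then have "poly W 1 - poly W (- 1) = poly V 1 - poly V (- 1)"
    by simp
  also have "\<dots> = h * (\<Sum>j<r. z j * (poly (I j) 1 - poly (I j) (- 1)))"
    by (simp add: V_def poly_sum right_diff_distrib sum_subtractf)
  also have "(\<Sum>j<r. z j * (poly (I j) 1 - poly (I j) (- 1))) = 2 * z 0"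
    using assms(2) unfolding I1 by (simp add: if_distrib sum.delta' cong: if_cong)
  finally show ?thesis
    by (simp add: W_def poly_sum mult.commute)
qed

section \<open>The Pade numerator from the kernel recurrence\<close>

lemma poly_pade:
  "poly (pade r) x = (\<Sum>j\<le>r. fact (2 * r - j) * fact r / (fact (2 * r) * fact j * fact (r - j)) * x ^ j)"
  by (simp add: pade_def poly_sum poly_monom)

text \<open>The kernel equations say that \<open>W = (\<Sum>k\<le>r. C k L\<^sub>k)\<close> solves \<open>W' = (x/2) (W - C r L\<^sub>r)\<close>; iterating
  \<open>W = C r L\<^sub>r + (2/x) W'\<close> gives \<open>W = C r (\<Sum>i\<le>r. (2/x)\<^sup>i L\<^sub>r\<^bsup>(i)\<^esup>)\<close>.\<close>

lemma pade_from_kernel: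
  fixes x e :: real
  assumes "x \<noteq> 0" and e: "e\<^sup>2 = 1"
    and kernel: "\<And>k. 1 \<le> k \<Longrightarrow> k \<le> r \<Longrightarrow>
      C k = x / 2 * (C (k - 1) / (2 * real k - 1) - (if k + 2 \<le> r then C (k + 1) / (2 * real k + 3) else 0))"
    and top: "C r = x ^ r * fact r / fact (2 * r)"
  shows "(\<Sum>k\<le>r. e ^ k * C k) = poly (pade r) (e * x)"
proof -
  define W where "W = (\<Sum>k\<le>r. Polynomial.smult (C k) (legendre k))"
  have "pderiv W = (\<Sum>k\<le>r. Polynomial.smult (C k) (pderiv (legendre k)))"
    by (simp add: W_def pderiv_sum pderiv_smult)
  also have "\<dots> = Polynomial.smult (x / 2) (\<Sum>j<r. Polynomial.smult (C j) (legendre j))"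
    using kernel by (rule legendre_derivative_eqI)
  also have "(\<Sum>j<r. Polynomial.smult (C j) (legendre j)) = W - Polynomial.smult (C r) (legendre r)"
    unfolding W_def lessThan_Suc_atMost[symmetric] by simp
  finally have dW: "pderiv W = Polynomial.smult (x / 2) (W - Polynomial.smult (C r) (legendre r))" .
  have W: "W = Polynomial.smult (C r) (legendre r) + Polynomial.smult (2 / x) (pderiv W)"
    unfolding dW using assms(1) by simp
  have expand: "W = (\<Sum>i<n. Polynomial.smult ((2 / x) ^ i * C r) ((pderiv ^^ i) (legendre r)))
      + Polynomial.smult ((2 / x) ^ n) ((pderiv ^^ n) W)" for n
  proof (induction n)
    case (Suc n)
    have "(pderiv ^^ n) W = Polynomial.smult (C r) ((pderiv ^^ n) (legendre r))
        + Polynomial.smult (2 / x) ((pderiv ^^ Suc n) W)"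
      by (subst W) (simp add: higher_pderiv_add higher_pderiv_smult higher_pderiv_Suc)
    then have "Polynomial.smult ((2 / x) ^ n) ((pderiv ^^ n) W)
        = Polynomial.smult ((2 / x) ^ n * C r) ((pderiv ^^ n) (legendre r))
        + Polynomial.smult ((2 / x) ^ Suc n) ((pderiv ^^ Suc n) W)"
      by (simp only: smult_add_right smult_smult power_Suc2)
    then show ?case
      unfolding sum.lessThan_Suc add.assoc by (rule subst) (rule Suc.IH)
  qed simp
  \<comment> \<open>Differentiating r + 1 times annihilates \<open>W\<close>, so the remainder in
    \<open>expand\<close> disappears.\<close>
  have "degree W \<le> r"
    unfolding W_def by (intro degree_sum_le) (auto intro: order.trans[OF degree_smult_le])
  then have "degree ((pderiv ^^ r) W) = 0"
    by (simp add: degree_higher_pderiv)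
  then have 0: "pderiv ((pderiv ^^ r) W) = 0"
    by (simp add: pderiv_eq_0_iff)
  have sol: "W = (\<Sum>i\<le>r. Polynomial.smult ((2 / x) ^ i * C r) ((pderiv ^^ i) (legendre r)))"
    using expand[of "Suc r", unfolded lessThan_Suc_atMost funpow.simps o_apply 0 smult_0_right add_0_right] .
  have "poly W e = (\<Sum>i\<le>r. (2 / x) ^ i * C r * poly ((pderiv ^^ i) (legendre r)) e)"
    by (subst sol) (simp add: poly_sum)
  \<comment> \<open>The powers of 2 cancel against the Legendre endpoint values, and
    \<open>top\<close> turns x^r / x^i into x^(r-i).\<close>
  also have "\<dots> = (\<Sum>i\<le>r. fact (r + i) * fact r / (fact (2 * r) * fact (r - i) * fact i) * (e * x) ^ (r - i))"
  proof (intro sum.cong refl)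
    fix i assume "i \<in> {..r}"
    then have "i \<le> r"
      by simp
    then have "x ^ r = x ^ i * x ^ (r - i)"
      by (simp add: power_add[symmetric])
    with \<open>i \<le> r\<close> show "(2 / x) ^ i * C r * poly ((pderiv ^^ i) (legendre r)) e
        = fact (r + i) * fact r / (fact (2 * r) * fact (r - i) * fact i) * (e * x) ^ (r - i)"
      using assms(1) by (simp add: poly_higher_pderiv_legendre[OF e] top power_divide power_mult_distrib mult_ac)
  qed
  also have "\<dots> = (\<Sum>j\<le>r. fact (2 * r - j) * fact r / (fact (2 * r) * fact j * fact (r - j)) * (e * x) ^ j)"
    by (rule sum.reindex_bij_witness[of _ "\<lambda>j. r - j" "\<lambda>i. r - i"]) (auto simp: mult_2)
  finally show ?thesis
    by (simp add: poly_pade W_def poly_sum poly_legendre_endpoint[OF e] mult.commute)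
qed

section \<open>Polynomials in a matrix\<close>

lemma matrix_power_commute: "X ** matrix_power X k = matrix_power X k ** X"
  by (induction k) (simp_all add: matrix_mul_assoc)

lemma poly_matrix_altdef:
  assumes "degree p \<le> n"
  shows "poly_matrix p X = (\<Sum>i\<le>n. coeff p i *\<^sub>R matrix_power X i)"
  unfolding poly_matrix_def using assms
  by (intro sum.mono_neutral_left) (auto simp: coeff_eq_0)

lemma poly_matrix_0 [simp]: "poly_matrix 0 X = 0"
  by (simp add: poly_matrix_def)

lemma poly_matrix_add: "poly_matrix (p + q) X = poly_matrix p X + poly_matrix q X"
  by (simp add: poly_matrix_altdef[of _ "max (degree p) (degree q)"] degree_add_le_max
      scaleR_add_left sum.distrib)

lemma poly_matrix_smult: "poly_matrix (Polynomial.smult a p) X = a *\<^sub>R poly_matrix p X"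
  by (simp add: poly_matrix_altdef[of _ "degree p"] scaleR_sum_right)

lemma poly_matrix_minus: "poly_matrix (- p) X = - poly_matrix p X"
  using poly_matrix_smult[of "-1" p X] by simp

lemma poly_matrix_diff: "poly_matrix (p - q) X = poly_matrix p X - poly_matrix q X"
  using poly_matrix_add[of p "- q" X] by (simp add: poly_matrix_minus)

lemma poly_matrix_sum: "poly_matrix (\<Sum>i\<in>A. f i) X = (\<Sum>i\<in>A. poly_matrix (f i) X)"
  by (induction A rule: infinite_finite_induct) (simp_all add: poly_matrix_add)

lemma matrix_mult_scaleR_right: "A ** (k *\<^sub>R B) = k *\<^sub>R (A ** B)" for A :: "real ^ 'm ^ 'm"
  by (simp add: matrix_scalar_ac scalar_matrix_assoc)

lemma matrix_mult_add_left: "(A + B) ** C = A ** C + B ** C" for A :: "real ^ 'm ^ 'm"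
  by (vector matrix_matrix_mult_def sum.distrib[symmetric] distrib_right)

lemma matrix_mult_sum_right: "A ** (\<Sum>i\<in>S. f i) = (\<Sum>i\<in>S. A ** f i)" for A :: "real ^ 'm ^ 'm"
  by (induction S rule: infinite_finite_induct) (simp_all add: matrix_add_ldistrib)

lemma matrix_vector_mult_sum_left: "(\<Sum>i\<in>S. f i) *v v = (\<Sum>i\<in>S. f i *v v)"
  for v :: "real ^ 'm"
  by (induction S rule: infinite_finite_induct) (simp_all add: matrix_vector_mult_add_rdistrib)

lemma matrix_vector_mult_sum_right: "A *v (\<Sum>i\<in>S. f i) = (\<Sum>i\<in>S. A *v f i)" for A :: "real ^ 'm ^ 'm"
  by (induction S rule: infinite_finite_induct) (simp_all add: matrix_vector_right_distrib)

text \<open>Horner form, which opens products and compositions to induction over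
  \<open>pCons\<close>.\<close>

lemma poly_matrix_pCons:
  "poly_matrix (pCons a p) X = a *\<^sub>R Finite_Cartesian_Product.mat 1 + X ** poly_matrix p X"
proof -
  have "poly_matrix (pCons a p) X = (\<Sum>i\<le>Suc (degree p). coeff (pCons a p) i *\<^sub>R matrix_power X i)"
    by (intro poly_matrix_altdef degree_pCons_le)
  also have "\<dots> = a *\<^sub>R Finite_Cartesian_Product.mat 1 + (\<Sum>i\<le>degree p. coeff p i *\<^sub>R (X ** matrix_power X i))"
    unfolding sum.atMost_Suc_shift by simp
  finally show ?thesis
    by (simp add: poly_matrix_def matrix_mult_sum_right matrix_mult_scaleR_right)
qed

lemma poly_matrix_1 [simp]: "poly_matrix 1 X = Finite_Cartesian_Product.mat 1"
  by (simp add: one_pCons poly_matrix_pCons)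

lemma poly_matrix_mult: "poly_matrix (p * q) X = poly_matrix p X ** poly_matrix q X"
proof (induction p)
  case (pCons a p)
  then show ?case
    by (simp add: poly_matrix_add poly_matrix_smult poly_matrix_pCons matrix_mult_add_left
        matrix_mul_assoc scalar_matrix_assoc[symmetric])
qed simp

text \<open>The determinant is a polynomial in the variable itself, whereas the theorem evaluates
  \<open>pade r\<close> at a negated matrix; this reconciles the two.\<close>

lemma poly_matrix_pcompose_uminus: "poly_matrix (pcompose p [:0, -1:]) X = poly_matrix p (- X)"
proof (induction p)
  case (pCons a p)
  have neg: "X ** (- B) = (- X) ** B" for B
    using scalar_matrix_assoc[of "-1" X B] matrix_mult_scaleR_right[of X "-1" B] by simp
  show ?case
    by (simp add: pcompose_pCons poly_matrix_add poly_matrix_pCons poly_matrix_mult poly_matrix_minus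
        pCons.IH neg)
qed simp

section \<open>The Pade numerators at accretive matrices\<close>

lemma coeff_pade:
  "coeff (pade r) j = (if j \<le> r then fact (2 * r - j) * fact r / (fact (2 * r) * fact j * fact (r - j)) else 0)"
  by (simp add: pade_def coeff_sum)

lemma pade_0 [simp]: "pade 0 = 1"
  by (simp add: pade_def)

lemma pade_1: "pade (Suc 0) = [:1, 1 / 2:]"
  by (simp add: pade_def numeral_2_eq_2 monom_altdef one_pCons)

text \<open>The case \<open>j = i + 2\<close>, \<open>n = i + m\<close> of the coefficient comparison in the recurrence for \<open>pade\<close>;
  \<open>F\<close>, \<open>N\<close>, \<open>T\<close>, \<open>I\<close>, \<open>M\<close> stand for the factorials of \<open>i + 2m\<close>, \<open>n\<close>, \<open>2n\<close>, \<open>i\<close>, \<open>m\<close>.\<close>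

lemma pade_coeff_identity:
  fixes i m F N T I M :: real
  assumes "i \<ge> 0" "m \<ge> 0"
  defines "n \<equiv> i + m"
  shows "(i + 2 * m + 2) * (i + 2 * m + 1) * F * ((n + 2) * (n + 1) * N)
      / ((2 * n + 4) * (2 * n + 3) * (2 * n + 2) * (2 * n + 1) * T * ((i + 2) * (i + 1) * I) * M)
    = F * ((n + 1) * N) / ((2 * n + 2) * (2 * n + 1) * T * ((i + 2) * (i + 1) * I) * M) * m
      + 1 / (4 * (2 * n + 1) * (2 * n + 3)) * (F * N / (T * I * M))"
proof -
  have nz: "2 * n + 4 \<noteq> 0" "2 * n + 3 \<noteq> 0" "2 * n + 2 \<noteq> 0" "2 * n + 1 \<noteq> 0" "i + 2 \<noteq> 0" "i + 1 \<noteq> 0"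
    "n + 1 \<noteq> 0" "n + 2 \<noteq> 0"
    using assms by auto
  have n4: "2 * n + 4 = 2 * (n + 2)" and n2: "2 * n + 2 = 2 * (n + 1)"
    by simp_all
  \<comment> \<open>\<open>1\<close>, \<open>2\<close> and \<open>3\<close> extract the same factor
    from the three terms.\<close>
  have 1: "X * Y * F * (b * a * N) / (2 * b * d * (2 * a) * e * T * (u * w * I) * M)
      = X * Y * (F * N / (T * I * M) / (4 * e * d * (u * w)))"
    if "a \<noteq> 0" "b \<noteq> 0" for X Y a b d e u w :: real
    using that by (simp add: mult_ac)
  have 2: "F * (a * N) / (2 * a * e * T * (u * w * I) * M) * m
      = 2 * m * d * (F * N / (T * I * M) / (4 * e * d * (u * w)))"
    if "a \<noteq> 0" "d \<noteq> 0" for a d e u w :: real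
    using that by (simp add: mult_ac)
  have 3: "1 / (4 * e * d) * (F * N / (T * I * M)) = u * w * (F * N / (T * I * M) / (4 * e * d * (u * w)))"
    if "u \<noteq> 0" "w \<noteq> 0" for d e u w :: real
    using that by (simp add: mult_ac)
  \<comment> \<open>What remains of the claim once the common factor is removed.\<close>
  have "(i + 2 * m + 2) * (i + 2 * m + 1) = 2 * m * (2 * n + 3) + (i + 2) * (i + 1)"
    unfolding n_def by (simp add: algebra_simps)
  then show ?thesis
    unfolding n4 n2 1[OF nz(7,8)] 2[OF nz(7,2)] 3[OF nz(5,6)] by (simp only: distrib_right)
qed

lemma pade_recurrence:
  "pade (Suc (Suc n)) = pade (Suc n)
    + Polynomial.smult (1 / (4 * (2 * real n + 1) * (2 * real n + 3))) (monom 1 2 * pade n)"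
proof (rule poly_eqI)
  fix j
  let ?c = "1 / (4 * (2 * real n + 1) * (2 * real n + 3))"
  have F: "fact (2 * Suc (Suc n)) = (2 * real n + 4) * (2 * real n + 3) * (2 * real n + 2) * (2 * real n + 1) * fact (2 * n)"
    "fact (2 * Suc n) = (2 * real n + 2) * (2 * real n + 1) * fact (2 * n)"
    "fact (Suc (Suc n)) = (real n + 2) * (real n + 1) * fact n"
    "fact (Suc n) = (real n + 1) * fact n"
    by (simp_all add: algebra_simps)
  \<comment> \<open>For j < 2 the factor \<open>monom 1 2\<close> contributes nothing, and for j > n
    + 2 all coefficients are zero; only the middle range needs the factorial identity.\<close>
  consider "j = 0" | "j = 1" | i m where "j = i + 2" "n = i + m" | "j > n + 2"
  proof (cases "j \<le> n + 2 \<and> j \<ge> 2")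
    case True
    then obtain i where "j = i + 2"
      by (metis add.commute le_Suc_ex)
    with True that(3)[of i "n - i"] show ?thesis
      by simp
  qed (use that in linarith)
  then show "coeff (pade (Suc (Suc n))) j = coeff (pade (Suc n) + Polynomial.smult ?c (monom 1 2 * pade n)) j"
  proof cases
    case 3
    have m: "2 * Suc (Suc n) - j = Suc (Suc (i + 2 * m))" "2 * Suc n - j = i + 2 * m" "Suc (Suc n) - j = m"
      "2 * n - i = i + 2 * m" "n - i = m" "j \<le> Suc (Suc n)" "i \<le> n"
      using 3 by simp_all
    have f: "fact (Suc (Suc (i + 2 * m))) = (real i + 2 * real m + 2) * (real i + 2 * real m + 1) * fact (i + 2 * m)"
      "fact j = (real i + 2) * (real i + 1) * fact i"
      using 3 by (simp_all add: algebra_simps)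
    have n: "real n = real i + real m"
      using 3 by simp
    \<comment> \<open>Writing 1 / (m-1)! as m / m! also covers m = 0, where j = n + 2 exceeds the
      degree of \<open>pade (Suc n)\<close>.\<close>
    have "coeff (pade (Suc n)) j = fact (i + 2 * m) * fact (Suc n) / (fact (2 * Suc n) * fact j * fact m) * real m"
    proof (cases m)
      case 0
      then show ?thesis
        using 3 by (simp add: coeff_pade)
    next
      case (Suc k)
      have k: "Suc n - j = k" "j \<le> Suc n" and fm: "real m / fact m = 1 / fact k"
        using 3 Suc by simp_all
      have "coeff (pade (Suc n)) j = fact (i + 2 * m) * fact (Suc n) / (fact (2 * Suc n) * fact j) * (1 / fact k)"
        using k m by (simp only: coeff_pade if_True) simp
      then show ?thesis
        unfolding fm[symmetric] by simp
    qed
    moreover have "coeff (monom 1 2 * pade n) j = fact (i + 2 * m) * fact n / (fact (2 * n) * fact i * fact m)"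
      using 3 m by (simp add: coeff_monom_mult coeff_pade)
    moreover have "coeff (pade (Suc (Suc n))) j
        = fact (Suc (Suc (i + 2 * m))) * fact (Suc (Suc n)) / (fact (2 * Suc (Suc n)) * fact j * fact m)"
      using m by (simp only: coeff_pade if_True)
    ultimately show ?thesis
      unfolding coeff_add coeff_smult F f
      using pade_coeff_identity[of "real i" "real m" "fact (i + 2 * m)" "fact n" "fact (2 * n)" "fact i" "fact m"]
      by (simp only: n of_nat_0_le_iff)
  next
    case 2
    then show ?thesis
      by (simp add: coeff_monom_mult coeff_pade, simp add: divide_simps, simp add: algebra_simps)
  qed (simp_all add: coeff_monom_mult coeff_pade)
qed

section \<open>Commuting polynomials in a matrix and the accretivity argument\<close>

lemma poly_matrix_X [simp]: "poly_matrix [:0, 1:] A = A"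
  by (simp add: poly_matrix_pCons)

lemma poly_matrix_monom: "poly_matrix (monom 1 k) A = matrix_power A k"
  by (induction k) (simp_all add: monom_Suc poly_matrix_pCons)

lemma poly_matrix_mult_commute: "poly_matrix p A ** poly_matrix q A = poly_matrix q A ** poly_matrix p A"
  by (simp add: poly_matrix_mult[symmetric] mult.commute)

lemma poly_matrix_commute: "A ** poly_matrix p A = poly_matrix p A ** A"
  using poly_matrix_mult_commute[of "[:0, 1:]" A p] by simp

text \<open>Matrix form of the scalar argument that \<open>w\<^sub>n = P\<^bsub>n+1\<^esub> / (z P\<^sub>n)\<close> satisfies
  \<open>w\<^bsub>n+1\<^esub> = 1/z + c\<^sub>n / w\<^sub>n\<close> and hence has positive real part when \<open>Re z \<ge> 0\<close>, \<open>z \<noteq> 0\<close>.\<close>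

lemma pade_accretive_bound:
  fixes A :: "real ^ 'm ^ 'm"
  assumes "\<And>x. inner x (A *v x) \<ge> 0"
  shows "\<exists>C>0. \<forall>v. C * (norm (matrix_power A (Suc n) *v v))\<^sup>2
    \<le> inner (poly_matrix (pade (Suc n)) A *v v) (A *v (poly_matrix (pade n) A *v v))"
proof (induction n)
  case 0
  have "inner (poly_matrix (pade (Suc 0)) A *v v) (A *v (poly_matrix (pade 0) A *v v))
      = inner v (A *v v) + 1 / 2 * (norm (A *v v))\<^sup>2" for v
    by (simp add: pade_1 poly_matrix_pCons matrix_mult_scaleR_right matrix_vector_mult_add_rdistrib
        scaleR_matrix_vector_assoc[symmetric] inner_add_left power2_norm_eq_inner)
  then show ?case
    using assms by (intro exI[of _ "1 / 2"]) simp
next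
  case (Suc n)
  then obtain C where C: "C > 0" and *: "\<And>v. C * (norm (matrix_power A (Suc n) *v v))\<^sup>2
      \<le> inner (poly_matrix (pade (Suc n)) A *v v) (A *v (poly_matrix (pade n) A *v v))"
    by blast
  define c where "c = 1 / (4 * (2 * real n + 1) * (2 * real n + 3))"
  have "c > 0"
    by (simp add: c_def)
  \<comment> \<open>The recurrence splits the inner product into a nonnegative term, by accretivity
    at P_(n+1)(A) v, and \<open>c\<close> times the induction hypothesis at
    \<open>A *v v\<close>.\<close>
  have "c * C * (norm (matrix_power A (Suc (Suc n)) *v v))\<^sup>2
    \<le> inner (poly_matrix (pade (Suc (Suc n))) A *v v) (A *v (poly_matrix (pade (Suc n)) A *v v))" for v
  proof -
    have pow: "matrix_power A (Suc (Suc n)) *v v = matrix_power A (Suc n) *v (A *v v)"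
      by (metis matrix_power.simps(2) matrix_power_commute matrix_vector_mul_assoc)
    have X2: "monom (1 :: real) 2 = [:0, 1:] * [:0, 1:]"
      by (simp add: monom_altdef power2_eq_square)
    have "poly_matrix (pade (Suc (Suc n))) A *v v
        = poly_matrix (pade (Suc n)) A *v v + c *\<^sub>R (A *v (A *v (poly_matrix (pade n) A *v v)))"
      unfolding pade_recurrence c_def[symmetric] X2 poly_matrix_add poly_matrix_smult poly_matrix_mult poly_matrix_X
      by (simp add: matrix_vector_mult_add_rdistrib scaleR_matrix_vector_assoc[symmetric]
          matrix_vector_mul_assoc matrix_mul_assoc)
    also have "A *v (poly_matrix (pade n) A *v v) = poly_matrix (pade n) A *v (A *v v)"
      by (simp add: matrix_vector_mul_assoc poly_matrix_commute)
    finally have "inner (poly_matrix (pade (Suc (Suc n))) A *v v) (A *v (poly_matrix (pade (Suc n)) A *v v))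
      = inner (poly_matrix (pade (Suc n)) A *v v) (A *v (poly_matrix (pade (Suc n)) A *v v))
      + c * inner (A *v (poly_matrix (pade n) A *v (A *v v))) (A *v (poly_matrix (pade (Suc n)) A *v v))"
      by (simp add: inner_add_left)
    moreover have "A *v (poly_matrix (pade (Suc n)) A *v v) = poly_matrix (pade (Suc n)) A *v (A *v v)"
      by (simp add: matrix_vector_mul_assoc poly_matrix_commute)
    moreover have "c * (C * (norm (matrix_power A (Suc n) *v (A *v v)))\<^sup>2)
        \<le> c * inner (A *v (poly_matrix (pade n) A *v (A *v v))) (poly_matrix (pade (Suc n)) A *v (A *v v))"
      using *[of "A *v v"] \<open>c > 0\<close> by (simp add: inner_commute)
    ultimately show ?thesis
      unfolding pow using assms[of "poly_matrix (pade (Suc n)) A *v v"] by (simp add: mult.assoc)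
  qed
  then show ?case
    using C \<open>c > 0\<close> by (intro exI[of _ "c * C"]) simp
qed

text \<open>For a kernel vector \<open>v\<close> the bound only yields A^r v = 0. Since
  \<open>pade r\<close> has constant term 1, the exponent can then be lowered step by step until A^0
  v = v = 0.\<close>

lemma invertible_pade_accretive:
  fixes A :: "real ^ 'm ^ 'm"
  assumes "\<And>x. inner x (A *v x) \<ge> 0"
  shows "invertible (poly_matrix (pade r) A)"
proof -
  have "v = 0" if v: "poly_matrix (pade r) A *v v = 0" for v
  proof -
    have "matrix_power A r *v v = 0"
    proof (cases r)
      case 0
      with v show ?thesis
        by simp
    next
      case (Suc n)
      obtain C where "C > 0" "C * (norm (matrix_power A r *v v))\<^sup>2 \<le> 0"
        using pade_accretive_bound[OF assms, of n] v Suc by (metis inner_zero_left)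
      then show ?thesis
        by (simp add: mult_le_0_iff)
    qed
    moreover have "matrix_power A k *v v = 0" if k: "matrix_power A (Suc k) *v v = 0" for k
    proof -
      \<comment> \<open>With P = 1 + z q, applying A^k to P(A) v = 0 expresses A^k v through A^(k+1)
        v.\<close>
      obtain a q where q: "pade r = pCons a q"
        by (rule pCons_cases)
      moreover have "coeff (pade r) 0 = 1"
        by (simp add: coeff_pade)
      ultimately have "pade r = 1 + [:0, 1:] * q"
        by (simp add: one_pCons)
      then have "monom 1 k * pade r = monom 1 k + q * monom 1 (Suc k)"
        by (simp add: monom_Suc algebra_simps)
      then have "matrix_power A k ** poly_matrix (pade r) A = matrix_power A k + poly_matrix q A ** matrix_power A (Suc k)"
        by (metis poly_matrix_add poly_matrix_monom poly_matrix_mult)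
      then have "matrix_power A k *v (poly_matrix (pade r) A *v v)
          = matrix_power A k *v v + poly_matrix q A *v (matrix_power A (Suc k) *v v)"
        by (metis matrix_vector_mul_assoc matrix_vector_mult_add_rdistrib)
      then show ?thesis
        unfolding v k by simp
    qed
    ultimately have "matrix_power A 0 *v v = 0"
      by (rule inc_induct[of 0 r "\<lambda>k. matrix_power A k *v v = 0", rotated]) simp_all
    then show "v = 0"
      by simp
  qed
  then show ?thesis
    using matrix_left_invertible_ker invertible_left_inverse by blast
qed

section \<open>Determinant and cofactors\<close>

lemma E_matrix_carrier [simp]: "E_matrix r \<in> carrier_mat (Suc r) (Suc r)"
  by (simp add: E_matrix_def)

lemma E_matrix_last_row: "j \<le> r \<Longrightarrow> E_matrix r $$ (r, j) = (- 1) ^ j"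
  by (simp add: E_matrix_def)

text \<open>Row \<open>i\<close> counts from 0, so \<open>i + 3 \<le> r\<close> is the condition k +
  2 <= r for k = i + 1. The sum form lets row sums split into three single terms.\<close>

lemma E_matrix_entry:
  assumes "i < r" "j \<le> r"
  shows "E_matrix r $$ (i, j) =
    (if j = i then monom (1 / 2 * (1 / (2 * real i + 1))) 1 else 0) + (if j = i + 1 then - 1 else 0)
      + (if j = i + 2 then if i + 3 \<le> r then monom (- (1 / 2) * (1 / (2 * real i + 5))) 1 else 0 else 0)"
  using assms by (auto simp: E_matrix_def Let_def algebra_simps)

text \<open>The general \<open>g\<close> serves both evaluation at a real number and substitution of
  a matrix.\<close>

lemma sum_E_matrix_row:
  fixes g :: "real poly \<Rightarrow> nat \<Rightarrow> 'b::comm_monoid_add"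
  assumes "i < r" and 0: "\<And>j. g 0 j = 0"
  shows "(\<Sum>j\<le>r. g (E_matrix r $$ (i, j)) j) = g (monom (1 / 2 * (1 / (2 * real i + 1))) 1) i + g (- 1) (i + 1)
    + (if i + 3 \<le> r then g (monom (- (1 / 2) * (1 / (2 * real i + 5))) 1) (i + 2) else 0)"
proof -
  have "(\<Sum>j\<le>r. g (E_matrix r $$ (i, j)) j) = (\<Sum>j\<le>r.
      (if j = i then g (monom (1 / 2 * (1 / (2 * real i + 1))) 1) i else 0) + (if j = i + 1 then g (- 1) (i + 1) else 0)
      + (if j = i + 2 then if i + 3 \<le> r then g (monom (- (1 / 2) * (1 / (2 * real i + 5))) 1) (i + 2) else 0 else 0))"
    using assms(1) by (intro sum.cong refl) (auto simp: E_matrix_entry 0)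
  also have "\<dots> = g (monom (1 / 2 * (1 / (2 * real i + 1))) 1) i + g (- 1) (i + 1)
    + (if i + 3 \<le> r then g (monom (- (1 / 2) * (1 / (2 * real i + 5))) 1) (i + 2) else 0)"
    using assms(1) by (simp add: sum.distrib)
  finally show ?thesis .
qed

text \<open>The entries of A adj(A) = adj(A) A = det(A) I.\<close>

lemma sum_mult_cofactor:
  fixes A :: "'a::comm_ring_1 mat"
  assumes A: "A \<in> carrier_mat n n" and "i < n" "j < n"
  shows "(\<Sum>k<n. A $$ (i, k) * cofactor A j k) = (if i = j then Determinant.det A else 0)"
    and "(\<Sum>k<n. cofactor A k i * A $$ (k, j)) = (if i = j then Determinant.det A else 0)"
proof -
  have "(A * adj_mat A) $$ (i, j) = (\<Sum>k<n. A $$ (i, k) * cofactor A j k)"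
    using assms by (auto simp: times_mat_def scalar_prod_def adj_mat_def lessThan_atLeast0 intro!: sum.cong)
  then show "(\<Sum>k<n. A $$ (i, k) * cofactor A j k) = (if i = j then Determinant.det A else 0)"
    using assms(2,3) A unfolding adj_mat(2)[OF A] by (cases "i = j") simp_all
  have "(adj_mat A * A) $$ (i, j) = (\<Sum>k<n. cofactor A k i * A $$ (k, j))"
    using assms by (auto simp: times_mat_def scalar_prod_def adj_mat_def lessThan_atLeast0 intro!: sum.cong)
  then show "(\<Sum>k<n. cofactor A k i * A $$ (k, j)) = (if i = j then Determinant.det A else 0)"
    using assms(2,3) A unfolding adj_mat(3)[OF A] by (cases "i = j") simp_all
qed

text \<open>(2r)! is 2^r r! times the product of the first \<open>r\<close> odd numbers.\<close>

lemma prod_odd_halves: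
  "(\<Prod>i<r. x / 2 * (1 / (2 * real i + 1))) = x ^ r * fact r / fact (2 * r)" for x :: real
proof (induction r)
  case (Suc r)
  have f: "fact (Suc r) = (real r + 1) * fact r" "fact (2 * Suc r) = 2 * (real r + 1) * (2 * real r + 1) * fact (2 * r)"
    by (simp_all add: algebra_simps)
  have "x ^ r * fact r / fact (2 * r) * (x / 2 * (1 / d)) = x ^ Suc r * (c * fact r) / (2 * c * d * fact (2 * r))"
    if "c \<noteq> 0" for c d :: real
    using that by (simp add: mult_ac)
  from this[of "real r + 1" "2 * real r + 1"] show ?case
    unfolding prod.lessThan_Suc f Suc by simp
qed simp

text \<open>Without its last row and column the matrix is upper triangular. The value is the
  normalization \<open>top\<close> of \<open>pade_from_kernel\<close>.\<close>

lemma cofactor_E_matrix_corner: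
  "poly (cofactor (E_matrix r) r r) x = x ^ r * fact r / fact (2 * r)"
proof -
  let ?B = "mat_delete (E_matrix r) r r"
  have B: "?B \<in> carrier_mat r r"
    using mat_delete_carrier[OF E_matrix_carrier, of r r r] by simp
  have entry: "?B $$ (i, j) = E_matrix r $$ (i, j)" if "i < r" "j < r" for i j
    using that mat_delete_index[OF E_matrix_carrier, of r r r i j] by (simp add: insert_index_def)
  have "upper_triangular ?B"
    using carrier_matD[OF E_matrix_carrier[of r]]
    by (intro upper_triangularI) (simp add: entry E_matrix_entry)
  then have "Determinant.det ?B = prod_list (diag_mat ?B)"
    using B by (rule det_upper_triangular)
  also have "\<dots> = (\<Prod>i<r. ?B $$ (i, i))"
    using carrier_matD[OF E_matrix_carrier[of r]] by (simp add: prod_list_diag_prod lessThan_atLeast0)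
  also have "\<dots> = (\<Prod>i<r. monom (1 / 2 * (1 / (2 * real i + 1))) 1)"
    by (intro prod.cong) (simp_all add: entry E_matrix_entry)
  finally have "poly (cofactor (E_matrix r) r r) x = (\<Prod>i<r. x / 2 * (1 / (2 * real i + 1)))"
    by (simp add: cofactor_def poly_prod poly_monom mult_2[symmetric])
  then show ?thesis
    by (simp only: prod_odd_halves)
qed

text \<open>Expansion along the last row with the \<open>i\<close>-th row in its place vanishes.\<close>

lemma cofactor_E_matrix_kernel:
  fixes r :: nat and x :: real
  defines "C \<equiv> \<lambda>k. poly (cofactor (E_matrix r) r k) x"
  assumes k: "1 \<le> k" "k \<le> r"
  shows "C k = x / 2 * (C (k - 1) / (2 * real k - 1) - (if k + 2 \<le> r then C (k + 1) / (2 * real k + 3) else 0))"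
proof -
  define i where "i = k - 1"
  have ki: "k = i + 1" "i < r"
    using k by (auto simp: i_def)
  have "(\<Sum>j\<le>r. E_matrix r $$ (i, j) * cofactor (E_matrix r) r j) = 0"
    using sum_mult_cofactor(1)[OF E_matrix_carrier, of i r r] ki by (simp add: lessThan_Suc_atMost)
  then have "0 = (\<Sum>j\<le>r. poly (E_matrix r $$ (i, j)) x * C j)"
    unfolding C_def by (metis (no_types, lifting) poly_0 poly_mult poly_sum sum.cong)
  also have "\<dots> = x / 2 * (1 / (2 * real i + 1)) * C i - C (i + 1)
      + (if i + 3 \<le> r then - (x / 2) * (1 / (2 * real i + 5)) * C (i + 2) else 0)"
    using ki by (subst sum_E_matrix_row[of i r "\<lambda>p j. poly p x * C j"]) (simp_all add: poly_monom)
  finally show ?thesis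
    using ki by (simp add: algebra_simps)
qed

lemma sum_power_cofactor_E_matrix:
  fixes e x :: real
  assumes "x \<noteq> 0" "e\<^sup>2 = 1"
  shows "(\<Sum>k\<le>r. e ^ k * poly (cofactor (E_matrix r) r k) x) = poly (pade r) (e * x)"
  using assms cofactor_E_matrix_kernel[of _ r x] cofactor_E_matrix_corner by (rule pade_from_kernel)

text \<open>Lifts identities obtained by dividing by \<open>x\<close>, hence only for nonzero
  \<open>x\<close>, to identities of polynomials.\<close>

lemma poly_eq_on_infinite:
  fixes p q :: "real poly"
  assumes "infinite S" "\<And>x. x \<in> S \<Longrightarrow> poly p x = poly q x"
  shows "p = q"
proof (rule ccontr)
  assume "p \<noteq> q"
  then have "finite {x. poly (p - q) x = 0}"
    by (intro poly_roots_finite) simp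
  moreover have "S \<subseteq> {x. poly (p - q) x = 0}"
    using assms(2) by auto
  ultimately show False
    using assms(1) finite_subset by blast
qed

text \<open>Laplace expansion along the alternating last row is the case e = -1 of
  \<open>sum_power_cofactor_E_matrix\<close>.\<close>

lemma det_E_matrix: "Determinant.det (E_matrix r) = pcompose (pade r) [:0, -1:]"
proof (rule poly_eq_on_infinite)
  show "infinite {0 :: real<..}"
    by (rule infinite_Ioi)
  fix x :: real
  assume "x \<in> {0<..}"
  then have "x \<noteq> 0"
    by simp
  have "Determinant.det (E_matrix r) = (\<Sum>j\<le>r. E_matrix r $$ (r, j) * cofactor (E_matrix r) r j)"
    using sum_mult_cofactor(1)[OF E_matrix_carrier, of r r r] by (simp add: lessThan_Suc_atMost)
  also have "\<dots> = (\<Sum>j\<le>r. (- 1) ^ j * cofactor (E_matrix r) r j)"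
    by (intro sum.cong) (simp_all add: E_matrix_last_row)
  finally have "poly (Determinant.det (E_matrix r)) x = (\<Sum>j\<le>r. (- 1) ^ j * poly (cofactor (E_matrix r) r j) x)"
    by (simp add: poly_sum)
  then show "poly (Determinant.det (E_matrix r)) x = poly (pcompose (pade r) [:0, -1:]) x"
    using sum_power_cofactor_E_matrix[OF \<open>x \<noteq> 0\<close>, of "- 1"] by (simp add: poly_pcompose)
qed

text \<open>The cases e = 1 and e = -1 are the two endpoint values of one Legendre sum; their
  difference is the increment formula with h = x / 2.\<close>

lemma cofactor_E_matrix_first:
  assumes "r \<ge> 1"
  shows "[:0, 1:] * cofactor (E_matrix r) r 0 = pade r - pcompose (pade r) [:0, -1:]"
proof (rule poly_eq_on_infinite)
  show "infinite {0 :: real<..}"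
    by (rule infinite_Ioi)
  fix x :: real
  assume "x \<in> {0<..}"
  then have "x \<noteq> 0"
    by simp
  let ?C = "\<lambda>k. poly (cofactor (E_matrix r) r k) x"
  have "(\<Sum>k\<le>r. ?C k) - (\<Sum>k\<le>r. (- 1) ^ k * ?C k) = 2 * (x / 2) * ?C 0"
    using cofactor_E_matrix_kernel assms by (intro legendre_derivative_increment legendre_derivative_eqI)
  then show "poly ([:0, 1:] * cofactor (E_matrix r) r 0) x = poly (pade r - pcompose (pade r) [:0, -1:]) x"
    using sum_power_cofactor_E_matrix[OF \<open>x \<noteq> 0\<close>, of 1 r] sum_power_cofactor_E_matrix[OF \<open>x \<noteq> 0\<close>, of "- 1" r]
    by (simp add: poly_pcompose)
qed

text \<open>With rows counted from 1 this sign is the (-1)^(k+1) of the theorem.\<close>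

lemma cofactor_E_matrix_phi: "cofactor (E_matrix r) k 0 = (- 1) ^ k * phi r (Suc k)"
  by (simp add: cofactor_def phi_def)

text \<open>Multiplying equation \<open>k\<close> by the cofactor at (k, i) and summing isolates
  \<open>y i\<close>. Cramer's rule applies to matrix-valued coefficients because all of them are
  polynomials in the same \<open>A\<close>.\<close>

lemma cramer_poly_matrix:
  fixes A :: "real ^ 'm ^ 'm"
  assumes B: "B \<in> carrier_mat n n" and "i < n"
    and system: "\<And>k. k < n \<Longrightarrow> (\<Sum>j<n. poly_matrix (B $$ (k, j)) A *v y j) = b k"
  shows "poly_matrix (Determinant.det B) A *v y i = (\<Sum>k<n. poly_matrix (cofactor B k i) A *v b k)"
proof -
  have "(\<Sum>k<n. poly_matrix (cofactor B k i) A *v b k)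
      = (\<Sum>k<n. \<Sum>j<n. poly_matrix (cofactor B k i * B $$ (k, j)) A *v y j)"
    by (intro sum.cong refl) (simp add: system[symmetric] matrix_vector_mult_sum_right
        matrix_vector_mul_assoc poly_matrix_mult)
  also have "\<dots> = (\<Sum>j<n. poly_matrix (\<Sum>k<n. cofactor B k i * B $$ (k, j)) A *v y j)"
    by (subst sum.swap) (simp add: poly_matrix_sum matrix_vector_mult_sum_left)
  also have "\<dots> = (\<Sum>j<n. if j = i then poly_matrix (Determinant.det B) A *v y i else 0)"
    using assms(2) by (intro sum.cong refl) (auto simp: sum_mult_cofactor(2)[OF B])
  finally show ?thesis
    using assms(2) by simp
qed

section \<open>Orthogonal projection of Legendre expansions\<close>

lemma integrable_poly: "integrable (lebesgue_on {a<..<b}) (poly p)" for p :: "real poly"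
proof -
  have "set_integrable lebesgue {a..b} (poly p)"
    by (intro absolutely_integrable_continuous_real continuous_intros)
  then have "set_integrable lebesgue {a<..<b} (poly p)"
    by (rule set_integrable_subset) auto
  then show ?thesis
    by (simp add: set_integrable_def integrable_restrict_space)
qed

lemma integral_poly: "integral\<^sup>L (lebesgue_on {a<..<b}) (poly p) = integral {a..b} (poly p)" for p :: "real poly"
  using lebesgue_integral_eq_integral[OF integrable_poly[of a b p]] by (simp add: integral_open_interval_real)

lemma integral_poly_add:
  "integral\<^sup>L (lebesgue_on {a<..<b}) (poly (p + q))
    = integral\<^sup>L (lebesgue_on {a<..<b}) (poly p) + integral\<^sup>L (lebesgue_on {a<..<b}) (poly q)"
  for p q :: "real poly"
proof -
  have "poly (p + q) = (\<lambda>x. poly p x + poly q x)"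
    by (simp add: fun_eq_iff)
  then show ?thesis
    by (simp only: Bochner_Integration.integral_add[OF integrable_poly integrable_poly])
qed

lemma integral_poly_smult:
  "integral\<^sup>L (lebesgue_on {a<..<b}) (poly (Polynomial.smult c p))
    = c * integral\<^sup>L (lebesgue_on {a<..<b}) (poly p)" for p :: "real poly"
proof -
  have "poly (Polynomial.smult c p) = (\<lambda>x. c * poly p x)"
    by (simp add: fun_eq_iff)
  then show ?thesis
    by simp
qed

lemma integral_pderiv:
  fixes p :: "real poly"
  assumes "a \<le> b"
  shows "integral\<^sup>L (lebesgue_on {a<..<b}) (poly (pderiv p)) = poly p b - poly p a"
  unfolding integral_poly
  using fundamental_theorem_of_calculus[OF assms, of "poly p" "poly (pderiv p)"]
  by (metis has_field_derivative_at_within has_real_derivative_iff_has_vector_derivative integral_unique poly_DERIV)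

lemma integral_poly_nonneg_eq_0:
  fixes p :: "real poly"
  assumes "a < b" "\<And>x. poly p x \<ge> 0" "integral\<^sup>L (lebesgue_on {a<..<b}) (poly p) = 0"
  shows "p = 0"
proof (rule poly_eq_on_infinite)
  show "infinite {a..b}"
    using assms(1) by (simp add: infinite_Icc)
  show "poly p x = poly 0 x" if "x \<in> {a..b}" for x
    using integral_eq_0_iff[of a b "poly p"] assms that unfolding integral_poly
    by (simp add: continuous_intros)
qed

text \<open>The affine map of (a, b) onto (-1, 1), as a polynomial so that \<open>pcompose\<close>
  yields the transformed Legendre polynomials.\<close>

definition ref_coord :: "real \<Rightarrow> real \<Rightarrow> real poly" where
  "ref_coord a b = [:- (a + b) / (b - a), 2 / (b - a):]"

lemma poly_ref_coord:
  assumes "a < b"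
  shows "poly (ref_coord a b) s = (2 * s - a - b) / (b - a)"
  using assms by (simp add: ref_coord_def divide_simps)

lemma poly_ref_coord_endpoints:
  assumes "a < b"
  shows "poly (ref_coord a b) a = - 1" and "poly (ref_coord a b) b = 1"
  using assms by (simp_all add: poly_ref_coord divide_simps)

lemma degree_ref_coord: "a < b \<Longrightarrow> degree (ref_coord a b) = 1"
  by (simp add: ref_coord_def)

text \<open>Repeated integration by parts moves the derivatives onto \<open>q\<close>, whose degree
  is too small to survive \<open>j\<close> of them.\<close>

lemma rodrigues_orthogonal:
  fixes q :: "real poly"
  assumes "a < b" "degree q < j" "j \<le> r"
  shows "integral\<^sup>L (lebesgue_on {a<..<b})
    (poly (pcompose ((pderiv ^^ j) ([:-1, 0, 1:] ^ r)) (ref_coord a b) * q)) = 0"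
  using assms(2,3)
proof (induction j arbitrary: q)
  case (Suc j)
  define G :: "real poly" where "G = (pderiv ^^ j) ([:-1, 0, 1:] ^ r)"
  let ?l = "ref_coord a b" and ?c = "2 / (b - a)"
  let ?I = "\<lambda>p. integral\<^sup>L (lebesgue_on {a<..<b}) (poly p)"
  \<comment> \<open>Boundary terms vanish: (x^2 - 1)^r has an \<open>r\<close>-fold zero at both
    endpoints and j < r.\<close>
  have "poly G e = 0" if "e\<^sup>2 = 1" for e
    using Suc.prems by (simp add: G_def poly_higher_pderiv coeff_quadratic_power_shift[OF that])
  then have "poly (pcompose G ?l * q) b - poly (pcompose G ?l * q) a = 0"
    using assms(1) by (simp add: poly_pcompose poly_ref_coord_endpoints)
  then have "0 = ?I (pderiv (pcompose G ?l * q))"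
    using assms(1) by (simp only: integral_pderiv less_imp_le)
  also have "pderiv (pcompose G ?l * q) = pcompose G ?l * pderiv q + Polynomial.smult ?c (pcompose (pderiv G) ?l * q)"
    by (simp add: pderiv_mult pderiv_pcompose ref_coord_def pderiv_pCons mult.commute)
  also have "?I \<dots> = ?I (pcompose G ?l * pderiv q) + ?c * ?I (pcompose (pderiv G) ?l * q)"
    by (simp only: integral_poly_add integral_poly_smult)
  \<comment> \<open>For constant \<open>q\<close> differentiation does not lower
    \<open>degree\<close>, so the induction hypothesis may not apply; there the integrand is
    zero.\<close>
  also have "?I (pcompose G ?l * pderiv q) = 0"
  proof (cases "degree q = 0")
    case True
    then have "pderiv q = 0"
      by (simp add: pderiv_eq_0_iff)
    then show ?thesis
      using integral_poly_smult[of a b 0 0] by simp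
  next
    case False
    then show ?thesis
      unfolding G_def using Suc.prems by (intro Suc.IH) (simp_all add: degree_pderiv)
  qed
  finally show ?case
    using assms(1) by (simp add: G_def)
qed simp

lemma legendre_orthogonal:
  fixes q :: "real poly"
  assumes "a < b" "degree q < r"
  shows "integral\<^sup>L (lebesgue_on {a<..<b}) (poly (pcompose (legendre r) (ref_coord a b) * q)) = 0"
  using rodrigues_orthogonal[OF assms order_refl] by (simp add: legendre_def pcompose_smult integral_poly_smult)

text \<open>The dropped top term is orthogonal to all lower degrees, so the truncated sum is a
  projection. Uniqueness, required by the description operator, follows by testing with the
  difference of two candidates.\<close>

lemma L2_proj_legendre:
  fixes Y :: "real \<Rightarrow> real ^ 'm"
  assumes "a < b" "r \<ge> 1"
    and Y: "\<And>s. s \<in> {a<..<b} \<Longrightarrow> Y s = (\<Sum>j\<le>r. poly (legendre j) (poly (ref_coord a b) s) *\<^sub>R y j)"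
  shows "L2_proj (r - 1) a b Y = (\<lambda>s. \<Sum>j<r. poly (legendre j) (poly (ref_coord a b) s) *\<^sub>R y j)"
    (is "_ = ?P")
proof -
  let ?I = "integral\<^sup>L (lebesgue_on {a<..<b})"
  let ?L = "\<lambda>j. pcompose (legendre j) (ref_coord a b)"
  have PL: "vec_nth (?P s) i = poly (\<Sum>j<r. Polynomial.smult (vec_nth (y j) i) (?L j)) s" for s i
    by (simp add: poly_sum poly_pcompose mult.commute)
  have P: "vec_poly_on (r - 1) UNIV ?P"
    unfolding vec_poly_on_def
  proof (intro allI exI conjI ballI)
    fix i
    show "degree (\<Sum>j<r. Polynomial.smult (vec_nth (y j) i) (?L j)) \<le> r - 1"
      by (intro degree_sum_le)
        (auto intro!: order.trans[OF degree_smult_le] simp: degree_pcompose degree_ref_coord[OF assms(1)])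
  qed (rule PL)
  have YP: "inner (Y s - ?P s) (q s) = poly (?L r * (\<Sum>i\<in>UNIV. Polynomial.smult (vec_nth (y r) i) (Q i))) s"
    if "s \<in> {a<..<b}" "\<And>i. vec_nth (q s) i = poly (Q i) s" for s q Q
  proof -
    have "Y s - ?P s = poly (?L r) s *\<^sub>R y r"
      using that(1) by (simp add: Y lessThan_Suc_atMost[symmetric] poly_pcompose)
    then show ?thesis
      by (simp add: inner_vec_def that(2) poly_sum sum_distrib_left mult_ac)
  qed
  have orth: "?I (\<lambda>s. inner (Y s - ?P s) (q s)) = 0" if q: "vec_poly_on (r - 1) UNIV q" for q
  proof -
    obtain Q where Q: "\<And>i. degree (Q i) \<le> r - 1" "\<And>i s. vec_nth (q s) i = poly (Q i) s"
      using q unfolding vec_poly_on_def by (metis UNIV_I)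
    have "degree (\<Sum>i\<in>UNIV. Polynomial.smult (vec_nth (y r) i) (Q i)) \<le> r - 1"
      using Q(1) by (intro degree_sum_le) (auto intro: order.trans[OF degree_smult_le])
    then have "?I (poly (?L r * (\<Sum>i\<in>UNIV. Polynomial.smult (vec_nth (y r) i) (Q i)))) = 0"
      using assms(1,2) by (intro legendre_orthogonal) auto
    moreover have "?I (\<lambda>s. inner (Y s - ?P s) (q s))
        = ?I (poly (?L r * (\<Sum>i\<in>UNIV. Polynomial.smult (vec_nth (y r) i) (Q i))))"
      by (intro Bochner_Integration.integral_cong refl YP) (simp_all add: Q)
    ultimately show ?thesis
      by simp
  qed
  show ?thesis
    unfolding L2_proj_def
  proof (rule the_equality, intro conjI allI impI P orth)
    fix p
    assume p: "vec_poly_on (r - 1) UNIV p \<and> (\<forall>q. vec_poly_on (r - 1) UNIV q \<longrightarrow> ?I (\<lambda>s. inner (Y s - p s) (q s)) = 0)"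
    then obtain e where e: "\<And>i. degree (e i) \<le> r - 1" "\<And>i s. vec_nth (p s) i = poly (e i) s"
      unfolding vec_poly_on_def by (metis UNIV_I)
    obtain d where d: "\<And>i. degree (d i) \<le> r - 1" "\<And>i s. vec_nth (?P s) i = poly (d i) s"
      using P unfolding vec_poly_on_def by (metis UNIV_I)
    define q where "q s = ?P s - p s" for s
    have qi: "vec_nth (q s) i = poly (d i - e i) s" for s i
      by (simp only: q_def vector_minus_component d e poly_diff)
    have q: "vec_poly_on (r - 1) UNIV q"
      unfolding vec_poly_on_def using qi d(1) e(1) by (blast intro: degree_diff_le)
    \<comment> \<open>On the interval \<open>p1\<close> is the pairing of the residual with
      \<open>q\<close>, which integrates to zero; \<open>p2\<close> is the squared norm of
      \<open>q\<close>.\<close>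
    define p1 where "p1 = ?L r * (\<Sum>i\<in>UNIV. Polynomial.smult (vec_nth (y r) i) (d i - e i))"
    define p2 where "p2 = (\<Sum>i\<in>UNIV. (d i - e i)\<^sup>2)"
    have p2: "poly p2 s = inner (q s) (q s)" for s
      by (simp add: p2_def inner_vec_def qi poly_sum power2_eq_square)
    have "0 = ?I (\<lambda>s. inner (Y s - p s) (q s))"
      using p q by simp
    also have "\<dots> = ?I (poly (p1 + p2))"
    proof (intro Bochner_Integration.integral_cong refl)
      fix s assume "s \<in> space (lebesgue_on {a<..<b})"
      then have "inner (Y s - ?P s) (q s) = poly p1 s"
        unfolding p1_def by (intro YP qi) simp
      moreover have "Y s - p s = (Y s - ?P s) + q s"
        by (simp add: q_def)
      ultimately show "inner (Y s - p s) (q s) = poly (p1 + p2) s"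
        by (simp only: poly_add p2 inner_add_left)
    qed
    also have "\<dots> = ?I (poly p1) + ?I (poly p2)"
      by (rule integral_poly_add)
    also have "?I (poly p1) = ?I (\<lambda>s. inner (Y s - ?P s) (q s))"
      unfolding p1_def by (intro Bochner_Integration.integral_cong refl YP[symmetric] qi) simp
    also have "\<dots> = 0"
      by (rule orth[OF q])
    finally have "?I (poly p2) = 0"
      by simp
    then have "p2 = 0"
      using assms(1) by (intro integral_poly_nonneg_eq_0[of a b]) (simp_all add: p2)
    then have "q s = 0" for s
      using p2[of s] by simp
    then show "p = ?P"
      by (simp add: q_def fun_eq_iff)
  qed
qed

section \<open>One step of the Galerkin method\<close>

lemma vec_poly_on_legendre_expansion:
  fixes Y :: "real \<Rightarrow> real ^ 'm"
  assumes "a < b" and Y: "vec_poly_on r {a<..<b} Y"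
  shows "\<exists>y. \<forall>s\<in>{a<..<b}. Y s = (\<Sum>j\<le>r. poly (legendre j) (poly (ref_coord a b) s) *\<^sub>R y j)"
proof -
  \<comment> \<open>Inverse of the affine map \<open>ref_coord a b\<close>.\<close>
  define m where "m = [:(a + b) / 2, (b - a) / 2:]"
  have "\<exists>c. \<forall>s\<in>{a<..<b}. vec_nth (Y s) i = (\<Sum>j\<le>r. poly (legendre j) (poly (ref_coord a b) s) * c j)" for i
  proof -
    obtain p where p: "degree p \<le> r" "\<And>s. s \<in> {a<..<b} \<Longrightarrow> vec_nth (Y s) i = poly p s"
      using Y unfolding vec_poly_on_def by blast
    have "degree (pcompose p m) \<le> r"
      using p(1) assms(1) by (simp add: m_def degree_pcompose)
    then obtain c where c: "pcompose p m = (\<Sum>j\<le>r. Polynomial.smult (c j) (legendre j))"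
      using legendre_expansion by blast
    have "poly m (poly (ref_coord a b) s) = s" for s
      using assms(1) by (simp add: m_def poly_ref_coord) (simp add: field_simps)
    then have "poly p s = (\<Sum>j\<le>r. poly (legendre j) (poly (ref_coord a b) s) * c j)" for s
      using arg_cong[OF c, of "\<lambda>q. poly q (poly (ref_coord a b) s)"]
      by (simp add: poly_pcompose poly_sum mult.commute)
    with p(2) show ?thesis
      by auto
  qed
  then obtain c where c: "\<And>i s. s \<in> {a<..<b} \<Longrightarrow>
      vec_nth (Y s) i = (\<Sum>j\<le>r. poly (legendre j) (poly (ref_coord a b) s) * c i j)"
    by metis
  have "Y s = (\<Sum>j\<le>r. poly (legendre j) (poly (ref_coord a b) s) *\<^sub>R (\<chi> i. c i j))"
    if "s \<in> {a<..<b}" for s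
    unfolding Finite_Cartesian_Product.vec_eq_iff using c[OF that] by simp
  then show ?thesis
    by (intro exI[of _ "\<lambda>j. \<chi> i. c i j"]) simp
qed

text \<open>Each component of the differential equation, pulled back to (-1, 1), is an identity
  between Legendre sums; coefficient comparison and integration then give the two
  conclusions.\<close>

lemma galerkin_legendre_system:
  fixes Y R :: "real \<Rightarrow> real ^ 'm" and D :: "real ^ 'm ^ 'm"
  defines "z \<equiv> \<lambda>y c j. D *v y j + c j"
  assumes "a < b" "r \<ge> 1"
    and Y: "\<forall>s\<in>{a<..<b}. Y s = (\<Sum>j\<le>r. poly (legendre j) (poly (ref_coord a b) s) *\<^sub>R y j)"
    and deriv: "\<forall>s\<in>{a<..<b}.
      (Y has_vector_derivative (D *v L2_proj (r - 1) a b Y s + L2_proj (r - 1) a b R s)) (at s)"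
    and R: "legendre_coeffs r a b R c"
  shows "\<And>k. 1 \<le> k \<Longrightarrow> k \<le> r \<Longrightarrow> y k = ((b - a) / 2) *\<^sub>R
      (z y c (k - 1) /\<^sub>R (2 * real k - 1) - (if k + 2 \<le> r then z y c (k + 1) /\<^sub>R (2 * real k + 3) else 0))"
    and "(\<Sum>k\<le>r. y k) - (\<Sum>k\<le>r. (- 1) ^ k *\<^sub>R y k) = (b - a) *\<^sub>R z y c 0"
proof -
  let ?l = "ref_coord a b" and ?h = "(b - a) / 2"
  have ode: "(\<Sum>k\<le>r. Polynomial.smult (vec_nth (y k) i) (pderiv (legendre k)))
      = Polynomial.smult ?h (\<Sum>j<r. Polynomial.smult (vec_nth (z y c j) i) (legendre j))" for i
  proof (rule poly_eq_on_infinite)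
    show "infinite {- 1 <..< 1 :: real}"
      by (rule infinite_Ioo) simp
    fix x :: real
    assume x: "x \<in> {- 1<..<1}"
    define s where "s = (a + b) / 2 + ?h * x"
    have "?h * x < ?h * 1" "?h * (- 1) < ?h * x"
      using x assms(2) by (intro mult_strict_left_mono; simp)+
    then have s: "s \<in> {a<..<b}"
      by (simp add: s_def field_simps)
    have ls: "poly ?l s = x"
      using assms(2) by (simp add: poly_ref_coord s_def divide_simps)
    define p where "p = pcompose (\<Sum>k\<le>r. Polynomial.smult (vec_nth (y k) i) (legendre k)) ?l"
    have "((\<lambda>s. vec_nth (Y s) i) has_vector_derivative
        vec_nth (D *v L2_proj (r - 1) a b Y s + L2_proj (r - 1) a b R s) i) (at s)"
      by (rule bounded_linear.has_vector_derivative[OF bounded_linear_vec_nth bspec[OF deriv s]])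
    moreover have "L2_proj (r - 1) a b Y s = (\<Sum>j<r. poly (legendre j) x *\<^sub>R y j)"
      using Y ls by (subst L2_proj_legendre[OF assms(2,3)]) auto
    moreover have "L2_proj (r - 1) a b R s = (\<Sum>j<r. poly (legendre j) x *\<^sub>R c j)"
      using R s ls assms(2) by (simp add: legendre_coeffs_def poly_ref_coord)
    ultimately have vd: "((\<lambda>s. vec_nth (Y s) i) has_vector_derivative
        (\<Sum>j<r. poly (legendre j) x * vec_nth (z y c j) i)) (at s)"
      by (simp add: z_def matrix_vector_mult_sum_right matrix_vector_mult_scaleR sum.distrib distrib_left)
    have "vec_nth (Y s) i = poly p s" if "s \<in> {a<..<b}" for s
      using bspec[OF Y that] by (simp add: p_def poly_pcompose poly_sum mult.commute)
    \<comment> \<open>\<open>Y\<close> is known to agree with \<open>p\<close> on the open interval,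
      which suffices to transfer the derivative at the interior point \<open>s\<close>.\<close>
    then have "(poly p has_vector_derivative (\<Sum>j<r. poly (legendre j) x * vec_nth (z y c j) i)) (at s)"
      using s by (intro has_vector_derivative_transform_within_open[OF vd, of "{a<..<b}"]) simp_all
    then have "poly (pderiv p) s = (\<Sum>j<r. poly (legendre j) x * vec_nth (z y c j) i)"
      unfolding has_real_derivative_iff_has_vector_derivative[symmetric]
      using DERIV_unique poly_DERIV by blast
    moreover have "poly (pderiv p) s
        = poly (\<Sum>k\<le>r. Polynomial.smult (vec_nth (y k) i) (pderiv (legendre k))) x * (2 / (b - a))"
      by (simp add: p_def pderiv_pcompose poly_pcompose ls pderiv_sum pderiv_smult)
        (simp add: ref_coord_def pderiv_pCons)
    ultimately show "poly (\<Sum>k\<le>r. Polynomial.smult (vec_nth (y k) i) (pderiv (legendre k))) x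
        = poly (Polynomial.smult ?h (\<Sum>j<r. Polynomial.smult (vec_nth (z y c j) i) (legendre j))) x"
      using assms(2) by (simp add: poly_sum mult.commute field_simps)
  qed
  show "y k = ?h *\<^sub>R (z y c (k - 1) /\<^sub>R (2 * real k - 1)
      - (if k + 2 \<le> r then z y c (k + 1) /\<^sub>R (2 * real k + 3) else 0))" if "1 \<le> k" "k \<le> r" for k
  proof (subst Finite_Cartesian_Product.vec_eq_iff, rule allI)
    fix i
    show "vec_nth (y k) i = vec_nth (?h *\<^sub>R (z y c (k - 1) /\<^sub>R (2 * real k - 1)
      - (if k + 2 \<le> r then z y c (k + 1) /\<^sub>R (2 * real k + 3) else 0))) i"
      using legendre_derivative_coeffs[OF ode that, of i]
      by (cases "k + 2 \<le> r") (simp_all only: vector_scaleR_component vector_minus_component real_scaleR_def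
        divide_inverse_commute if_True if_False zero_index)
  qed
  show "(\<Sum>k\<le>r. y k) - (\<Sum>k\<le>r. (- 1) ^ k *\<^sub>R y k) = (b - a) *\<^sub>R z y c 0"
    unfolding Finite_Cartesian_Product.vec_eq_iff
    using legendre_derivative_increment[OF ode assms(3)] by (simp del: right_diff_distrib_numeral)
qed

text \<open>The expansion holds on the open interval and extends to its closure by
  continuity.\<close>

lemma legendre_sum_endpoints:
  fixes Y :: "real \<Rightarrow> real ^ 'm"
  assumes "a < b" "continuous_on {a..b} Y"
    and Y: "\<forall>s\<in>{a<..<b}. Y s = (\<Sum>j\<le>r. poly (legendre j) (poly (ref_coord a b) s) *\<^sub>R y j)"
  shows "Y a = (\<Sum>j\<le>r. (- 1) ^ j *\<^sub>R y j)" and "Y b = (\<Sum>j\<le>r. y j)"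
proof -
  let ?F = "\<lambda>s. \<Sum>j\<le>r. poly (legendre j) (poly (ref_coord a b) s) *\<^sub>R y j"
  have cl: "closure {a<..<b} = {a..b}"
    using assms(1) by simp
  have "Y s - ?F s = 0" if "s \<in> {a..b}" for s
  proof (rule continuous_constant_on_closure[of "{a<..<b}" "\<lambda>s. Y s - ?F s"])
    show "continuous_on (closure {a<..<b}) (\<lambda>s. Y s - ?F s)"
      unfolding cl by (intro continuous_intros assms(2))
  qed (use that Y cl in auto)
  from this[of a] this[of b] show "Y a = (\<Sum>j\<le>r. (- 1) ^ j *\<^sub>R y j)" "Y b = (\<Sum>j\<le>r. y j)"
    using assms(1) by (simp_all add: poly_ref_coord_endpoints)
qed

lemma uminus_matrix_vector_mult: "(- M) *v v = - (M *v v)" for M :: "real ^ 'm ^ 'm"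
  using scaleR_matrix_vector_assoc[of "-1" M v] by simp

lemma poly_matrix_minus_one_power: "poly_matrix ((- 1) ^ j) A *v v = (- 1) ^ j *\<^sub>R v"
  by (cases "even j") (simp_all add: poly_matrix_minus uminus_matrix_vector_mult)

lemma poly_matrix_monom_1: "poly_matrix (monom c 1) A = c *\<^sub>R A"
proof -
  have "monom c 1 = Polynomial.smult c [:0, 1:]"
    by (simp add: monom_altdef)
  then show ?thesis
    by (simp only: poly_matrix_smult poly_matrix_X)
qed

text \<open>In \<open>rec\<close>, the part of \<open>z\<close> containing \<open>D\<close> moves to
  the left and builds the matrix row; the part containing \<open>c\<close> stays on the right as
  \<open>load\<close>.\<close>

lemma E_matrix_system:
  fixes D :: "real ^ 'm ^ 'm" and y c :: "nat \<Rightarrow> real ^ 'm"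
  defines "z \<equiv> \<lambda>j. D *v y j + c j"
  assumes "i < r"
    and rec: "y (Suc i) = (\<tau> / 2) *\<^sub>R (z i /\<^sub>R (2 * real (Suc i) - 1)
      - (if Suc i + 2 \<le> r then z (Suc i + 1) /\<^sub>R (2 * real (Suc i) + 3) else 0))"
  shows "(\<Sum>j\<le>r. poly_matrix (E_matrix r $$ (i, j)) (\<tau> *\<^sub>R D) *v y j) = load r \<tau> c (Suc i)"
proof -
  define d e where "d = 2 * real i + 1" and "e = 2 * real i + 5"
  have de: "2 * real (Suc i) - 1 = d" "2 * real (Suc i) + 3 = e"
    by (simp_all add: d_def e_def)
  note row = sum_E_matrix_row[of i r "\<lambda>p j. poly_matrix p (\<tau> *\<^sub>R D) *v y j", OF assms(2), folded d_def e_def]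
  have "Suc i + 2 \<le> r \<longleftrightarrow> i + 3 \<le> r"
    by linarith
  then show ?thesis
    unfolding load_def de
    by (subst row) (simp_all add: poly_matrix_monom_1[unfolded One_nat_def] poly_matrix_minus uminus_matrix_vector_mult
        rec[unfolded de] z_def scaleR_matrix_vector_assoc[symmetric] scaleR_add_right scaleR_diff_right
        inverse_eq_divide)
qed

lemma matrix_inv:
  fixes B :: "real ^ 'm ^ 'm"
  assumes "invertible B"
  shows "B ** matrix_inv B = Finite_Cartesian_Product.mat 1" "matrix_inv B ** B = Finite_Cartesian_Product.mat 1"
  using someI_ex[OF assms[unfolded invertible_def]] by (simp_all add: matrix_inv_def)

lemma matrix_inv_commute:
  fixes B M :: "real ^ 'm ^ 'm"
  assumes "invertible B" "B ** M = M ** B"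
  shows "M ** matrix_inv B = matrix_inv B ** M"
  by (metis assms matrix_inv matrix_mul_assoc matrix_mul_lid matrix_mul_rid)

lemma galerkin_step:
  fixes Y R :: "real \<Rightarrow> real ^ 'm" and D :: "real ^ 'm ^ 'm"
  assumes "a < b" "r \<ge> 1"
    and diss: "\<And>x. inner x (D *v x) \<le> 0"
    and cont: "continuous_on {a..b} Y" and poly: "vec_poly_on r {a<..<b} Y"
    and deriv: "\<forall>s\<in>{a<..<b}.
      (Y has_vector_derivative (D *v L2_proj (r - 1) a b Y s + L2_proj (r - 1) a b R s)) (at s)"
    and R: "legendre_coeffs r a b R c"
    and \<tau>: "\<tau> = b - a"
  shows "Y b =
      matrix_quot (poly_matrix (pade r) (\<tau> *\<^sub>R D)) (poly_matrix (pade r) (- (\<tau> *\<^sub>R D))) *v Y a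
      + (\<tau> *\<^sub>R D) *v (\<Sum>k=1..r. (- 1) ^ (k + 1) *\<^sub>R
          (matrix_quot (poly_matrix (phi r k) (\<tau> *\<^sub>R D)) (poly_matrix (pade r) (- (\<tau> *\<^sub>R D))) *v load r \<tau> c k))
      + \<tau> *\<^sub>R c 0"
proof -
  obtain y where y: "\<forall>s\<in>{a<..<b}. Y s = (\<Sum>j\<le>r. poly (legendre j) (poly (ref_coord a b) s) *\<^sub>R y j)"
    using vec_poly_on_legendre_expansion[OF assms(1) poly] by blast
  define A where "A = \<tau> *\<^sub>R D"
  define B where "B = poly_matrix (pade r) (- A)"
  define C where "C = poly_matrix (cofactor (E_matrix r) r 0) A"
  define f where "f k = poly_matrix (phi r k) A" for k
  note sys = galerkin_legendre_system[OF assms(1,2) y deriv R, folded \<tau>]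
  note ends = legendre_sum_endpoints[OF assms(1) cont y]
  \<comment> \<open>The integrated equation: the increment of \<open>Y\<close> involves only the
    mean coefficients \<open>y 0\<close> and \<open>c 0\<close>.\<close>
  have Yb: "Y b = Y a + A *v y 0 + \<tau> *\<^sub>R c 0"
    unfolding ends using sys(2)
    by (simp add: A_def scaleR_matrix_vector_assoc[symmetric] algebra_simps)
  have "inner x (- A *v x) \<ge> 0" for x
    using diss[of x] assms(1) \<tau> by (simp add: A_def scaleR_matrix_vector_assoc[symmetric]
      uminus_matrix_vector_mult mult_nonneg_nonpos)
  then have inv: "invertible B"
    unfolding B_def by (rule invertible_pade_accretive)
  have B: "B = poly_matrix (pcompose (pade r) [:0, -1:]) A"
    by (simp add: B_def poly_matrix_pcompose_uminus)
  have comm: "poly_matrix p A ** matrix_inv B = matrix_inv B ** poly_matrix p A" for p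
    unfolding B by (intro matrix_inv_commute poly_matrix_mult_commute inv[unfolded B])
  \<comment> \<open>This replaces the cofactor multiplying \<open>Y a\<close> by Pade
    numerators.\<close>
  have AC: "A ** C = poly_matrix (pade r) A - B"
    using arg_cong[OF cofactor_E_matrix_first[OF assms(2)], of "\<lambda>p. poly_matrix p A"]
    by (simp only: poly_matrix_mult poly_matrix_X poly_matrix_diff B C_def)
  \<comment> \<open>The first \<open>r\<close> rows carry the loads; the last row is the value of
    the expansion at the left endpoint.\<close>
  have "poly_matrix (Determinant.det (E_matrix r)) A *v y 0
      = (\<Sum>k<Suc r. poly_matrix (cofactor (E_matrix r) k 0) A *v (if k < r then load r \<tau> c (Suc k) else Y a))"
  proof (rule cramer_poly_matrix[OF E_matrix_carrier])
    fix k assume "k < Suc r"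
    show "(\<Sum>j<Suc r. poly_matrix (E_matrix r $$ (k, j)) A *v y j) = (if k < r then load r \<tau> c (Suc k) else Y a)"
    proof (cases "k < r")
      case True
      then show ?thesis
        unfolding lessThan_Suc_atMost A_def using sys(1)[of "Suc k"] by (subst E_matrix_system) simp_all
    next
      case False
      with \<open>k < Suc r\<close> have "k = r"
        by simp
      then show ?thesis
        by (simp add: lessThan_Suc_atMost E_matrix_last_row poly_matrix_minus_one_power ends cong: sum.cong_simp)
    qed
  qed simp
  then have "B *v y 0 = (\<Sum>k<r. (- 1) ^ k *\<^sub>R (f (Suc k) *v load r \<tau> c (Suc k))) + C *v Y a" (is "_ = ?S + _")
    by (simp add: det_E_matrix B[symmetric] C_def f_def cofactor_E_matrix_phi poly_matrix_mult
        matrix_vector_mul_assoc[symmetric] poly_matrix_minus_one_power)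
  then have "y 0 = matrix_inv B *v (?S + C *v Y a)"
    by (metis inv matrix_inv(2) matrix_vector_mul_assoc matrix_vector_mul_lid)
  also have "\<dots> = (\<Sum>k<r. (- 1) ^ k *\<^sub>R ((f (Suc k) ** matrix_inv B) *v load r \<tau> c (Suc k)))
      + (C ** matrix_inv B) *v Y a"
    by (simp add: C_def f_def comm matrix_vector_right_distrib matrix_vector_mult_sum_right
        matrix_vector_mult_scaleR matrix_vector_mul_assoc)
  also have "(\<Sum>k<r. (- 1) ^ k *\<^sub>R ((f (Suc k) ** matrix_inv B) *v load r \<tau> c (Suc k)))
      = (\<Sum>k=1..r. (- 1) ^ (k + 1) *\<^sub>R ((f k ** matrix_inv B) *v load r \<tau> c k))" (is "_ = ?T")
    by (simp add: sum.atLeast1_atMost_eq)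
  finally have "A *v y 0 = A *v ?T + ((A ** C) ** matrix_inv B) *v Y a"
    by (simp add: matrix_vector_right_distrib matrix_vector_mul_assoc matrix_mul_assoc)
  \<comment> \<open>The resulting \<open>- Y a\<close> cancels the \<open>Y a\<close> in
    \<open>Yb\<close>, leaving the Pade quotient alone.\<close>
  moreover have "((A ** C) ** matrix_inv B) *v Y a = (poly_matrix (pade r) A ** matrix_inv B) *v Y a - Y a"
    unfolding AC using matrix_inv(1)[OF inv]
    by (simp add: matrix_vector_mul_assoc[symmetric] matrix_vector_mult_diff_rdistrib)
      (simp add: matrix_vector_mul_assoc)
  ultimately show ?thesis
    unfolding Yb matrix_quot_def f_def A_def[symmetric] B_def[symmetric] by (simp add: algebra_simps)
qed

theorem theorem3p3:
  fixes T :: real and N r :: nat and t :: "nat \<Rightarrow> real"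
    and D :: "real ^ 'm ^ 'm" and Y0 :: "real ^ 'm" and R Y :: "real \<Rightarrow> real ^ 'm"
    and Rc :: "nat \<Rightarrow> nat \<Rightarrow> real ^ 'm" and \<tau> :: "nat \<Rightarrow> real"
  assumes "T > 0" and "time_partition t N T"
    and "\<And>n. \<tau> n = t (Suc n) - t n"
    and "square_integrable_on R {0<..<T}"
    and "r \<ge> 1"
    and "negative_semidefinite (D + transpose D)"
    and "galerkin_solution t N r D R Y0 Y"
    and "\<And>n. n < N \<Longrightarrow> legendre_coeffs r (t n) (t (Suc n)) R (Rc n)"
  shows "\<forall>n\<in>{1..N - 1}.
    Y (t (Suc n)) =
      matrix_quot (poly_matrix (pade r) (\<tau> n *\<^sub>R D)) (poly_matrix (pade r) (- (\<tau> n *\<^sub>R D))) *v Y (t n)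
      + (\<tau> n *\<^sub>R D) *v (\<Sum>k=1..r. (- 1) ^ (k + 1) *\<^sub>R
          (matrix_quot (poly_matrix (phi r k) (\<tau> n *\<^sub>R D)) (poly_matrix (pade r) (- (\<tau> n *\<^sub>R D)))
             *v load r (\<tau> n) (Rc n) k))
      + \<tau> n *\<^sub>R Rc n 0"
proof
  fix n assume "n \<in> {1..N - 1}"
  then have n: "n < N"
    by auto
  have t: "t n < t (Suc n)" if "n < N" for n
    using assms(2) that by (simp add: time_partition_def)
  have mono: "t i \<le> t j" if "i \<le> j" "j \<le> N" for i j
    using that
  proof (induction j)
    case (Suc j)
    then show ?case
      using t[of j] by (cases "i = Suc j") auto
  qed simp
  \<comment> \<open>\<open>D\<close> and its transpose have the same quadratic form, so that of the
    symmetric sum is twice that of \<open>D\<close>.\<close>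
  have diss: "inner x (D *v x) \<le> 0" for x
  proof -
    have "inner x ((D + transpose D) *v x) \<le> 0"
      using assms(6) by (simp add: negative_semidefinite_def)
    moreover have "inner x (transpose D *v x) = inner x (D *v x)"
      by (simp add: transpose_matrix_vector inner_commute[of x] dot_lmul_matrix)
    ultimately show ?thesis
      by (simp add: matrix_vector_mult_add_rdistrib inner_add_right)
  qed
  have Y: "continuous_on {t 0..t N} Y" "vec_poly_on r {t n<..<t (Suc n)} Y"
    "\<forall>s\<in>{t n<..<t (Suc n)}. (Y has_vector_derivative
        (D *v L2_proj (r - 1) (t n) (t (Suc n)) Y s + L2_proj (r - 1) (t n) (t (Suc n)) R s)) (at s)"
    using assms(7) n unfolding galerkin_solution_def V_space_def by blast+
  have "continuous_on {t n..t (Suc n)} Y"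
    using Y(1) mono[of 0 n] mono[of "Suc n" N] n by (elim continuous_on_subset) auto
  from galerkin_step[OF t[OF n] assms(5) diss this Y(2,3) assms(8)[OF n] assms(3)]
  show "Y (t (Suc n)) =
      matrix_quot (poly_matrix (pade r) (\<tau> n *\<^sub>R D)) (poly_matrix (pade r) (- (\<tau> n *\<^sub>R D))) *v Y (t n)
      + (\<tau> n *\<^sub>R D) *v (\<Sum>k=1..r. (- 1) ^ (k + 1) *\<^sub>R
          (matrix_quot (poly_matrix (phi r k) (\<tau> n *\<^sub>R D)) (poly_matrix (pade r) (- (\<tau> n *\<^sub>R D)))
             *v load r (\<tau> n) (Rc n) k))
      + \<tau> n *\<^sub>R Rc n 0" .
qed

end
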